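(* Let $X_1,X_2,\ldots$ be i.i.d. data from $P$, let $\psi=\psi(P)\in\mathbb R$, $\hat\psi_n=\psi(\hat P_n)$, and let $\psi_n^{*1},\ldots,\psi_n^{*B}$ be the bootstrap resample estimates. Assume that for some $\sigma^2>0$, $\sqrt n(\hat\psi_n-\psi)\Rightarrow N(0,\sigma^2)$, and that a resample estimate $\psi_n^*$ satisfies $\sqrt n(\psi_n^*-\hat\psi_n)\Rightarrow N(0,\sigma^2)$ conditionally on the data in probability, as $n\to\infty$. Let $\alpha\in(0,1)$. Then for any fixed integer $B\ge 1$, the interval $$\mathcal I=\left[\hat\psi_n-t_{B,1-\alpha/2}S,\ \hat\psi_n+t_{B,1-\alpha/2}S\right],\qquad S^2=\frac1B\sum_{b=1}^B(\psi_n^{*b}-\hat\psi_n)^2,\ S\ge 0,$$ satisfies $\mathbb P_n(\psi\in\mathcal I)\to 1-\alpha$ as $n\to\infty$, where $\mathbb P_n$ denotes the probability with respect to the data $X_1,\ldots,X_n$ and all randomness from the resampling.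
   Context: $\psi(\cdot)$ is a real-valued functional on probability distributions on the data domain. $\hat P_n(\cdot)=\frac1n\sum_{i=1}^n I(X_i\in\cdot)$ is the empirical distribution. For each $b=1,\ldots,B$, independently across $b$ given the data, $X_1^{*b},\ldots,X_n^{*b}$ are drawn independently and uniformly with replacement from $\{X_1,\ldots,X_n\}$, $P_n^{*b}$ is their empirical distribution, and $\psi_n^{*b}=\psi(P_n^{*b})$; $\psi_n^*$ denotes a generic one of these. "$\Rightarrow$" is convergence in distribution. "$\sqrt n(\psi_n^*-\hat\psi_n)\Rightarrow N(0,\sigma^2)$ conditionally on the data in probability" means $P(\sqrt n(\psi_n^*-\hat\psi_n)\le x\mid\hat P_n)\stackrel{p}{\to}P(N(0,\sigma^2)\le x)$ for every $x\in\mathbb R$. $t_{B,q}$ is the $q$-quantile of Student's $t$-distribution with $B$ degrees of freedom. *)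

theory Defs
  imports "HOL-Probability.Probability"
begin

text \<open>The data domain is a measurable space \<open>D\<close>. Observations are numbered from \<open>0\<close>, so
  \<open>X\<^sub>1, \<dots>, X\<^sub>n\<close> become \<open>X 0, \<dots>, X (n - 1)\<close>, and the resamples are numbered by \<open>b < B\<close>.\<close>

definition empirical :: "'a measure \<Rightarrow> nat \<Rightarrow> (nat \<Rightarrow> 'a) \<Rightarrow> 'a measure" where
  "empirical D n x = distr (uniform_count_measure {..<n}) D x"

lemma sets_empirical [simp]: "sets (empirical D n x) = sets D"
  by (simp add: empirical_def)

lemma measure_empirical:
  assumes x: "\<And>i. i < n \<Longrightarrow> x i \<in> space D" and A: "A \<in> sets D"
  shows "measure (empirical D n x) A = 1 / real n * (\<Sum>i<n. indicator A (x i))"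
proof -
  let ?U = "uniform_count_measure {..<n}"
  have "x \<in> measurable ?U D"
    using x by (auto simp: measurable_def space_uniform_count_measure sets_uniform_count_measure)
  then have "measure (empirical D n x) A = measure ?U {i. i < n \<and> x i \<in> A}"
    by (simp add: empirical_def measure_distr[OF _ A] space_uniform_count_measure vimage_def
        Int_def conj_commute)
  also have "\<dots> = real (card {i. i < n \<and> x i \<in> A}) / real n"
    by (subst measure_uniform_count_measure) auto
  also have "real (card {i. i < n \<and> x i \<in> A}) = (\<Sum>i<n. indicator A (x i))"
    by (simp add: indicator_def sum.If_cases Int_def conj_commute)
  finally show ?thesis by simp
qed

definition data_sigma ::
  "'w measure \<Rightarrow> 'a measure \<Rightarrow> (nat \<Rightarrow> 'w \<Rightarrow> 'a) \<Rightarrow> nat \<Rightarrow> 'w measure" where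
  "data_sigma M D X n =
     vimage_algebra (space M) (\<lambda>\<omega>. \<lambda>i\<in>{..<n}. X i \<omega>) (PiM {..<n} (\<lambda>_. D))"

definition empirical_sigma ::
  "'w measure \<Rightarrow> 'a measure \<Rightarrow> (nat \<Rightarrow> 'w \<Rightarrow> 'a) \<Rightarrow> nat \<Rightarrow> 'w measure" where
  "empirical_sigma M D X n =
     vimage_algebra (space M) (\<lambda>\<omega>. empirical D n (\<lambda>i. X i \<omega>)) (prob_algebra D)"

text \<open>\<open>Xs b i\<close>, for \<open>b < B\<close> and \<open>i < n\<close>, is the \<open>i\<close>-th point of the \<open>b\<close>-th resample. Given the data,
  all these points are independent, within and across resamples, and each of them is a uniform
  draw from the \<open>n\<close> observations counted with multiplicity, that is, a draw from their
  empirical distribution.\<close>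

definition bootstrap_resamples ::
  "'w measure \<Rightarrow> 'a measure \<Rightarrow> (nat \<Rightarrow> 'w \<Rightarrow> 'a) \<Rightarrow> nat \<Rightarrow> nat \<Rightarrow> (nat \<Rightarrow> nat \<Rightarrow> 'w \<Rightarrow> 'a) \<Rightarrow> bool"
where
  "bootstrap_resamples M D X n B Xs \<longleftrightarrow>
     (\<forall>b<B. \<forall>i<n. Xs b i \<in> measurable M D) \<and>
     (\<forall>A. (\<forall>b<B. \<forall>i<n. A b i \<in> sets D) \<longrightarrow>
        (AE \<omega> in M.
           real_cond_exp M (data_sigma M D X n)
             (indicator {\<omega> \<in> space M. \<forall>b<B. \<forall>i<n. Xs b i \<omega> \<in> A b i}) \<omega>
           = (\<Prod>b<B. \<Prod>i<n. measure (empirical D n (\<lambda>j. X j \<omega>)) (A b i))))"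

text \<open>\<open>N(0, \<sigma>\<^sup>2)\<close>; the parameter is the standard deviation.\<close>

definition centered_normal :: "real \<Rightarrow> real measure" where
  "centered_normal \<sigma> = density lborel (normal_density 0 \<sigma>)"

definition conv_in_prob :: "'w measure \<Rightarrow> (nat \<Rightarrow> 'w \<Rightarrow> real) \<Rightarrow> real \<Rightarrow> bool" where
  "conv_in_prob M Y c \<longleftrightarrow>
     (\<forall>\<epsilon>>0. (\<lambda>n. measure M {\<omega> \<in> space M. \<bar>Y n \<omega> - c\<bar> > \<epsilon>}) \<longlonglongrightarrow> 0)"

definition student_t_density :: "nat \<Rightarrow> real \<Rightarrow> real" where
  "student_t_density k x =
     Gamma ((real k + 1) / 2) / (sqrt (real k * pi) * Gamma (real k / 2)) *
     (1 + x\<^sup>2 / real k) powr (- (real k + 1) / 2)"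

definition student_t :: "nat \<Rightarrow> real measure" where
  "student_t k = density lborel (student_t_density k)"

definition quantile :: "real measure \<Rightarrow> real \<Rightarrow> real" where
  "quantile N q = Inf {x. q \<le> cdf N x}"

definition boot_S :: "nat \<Rightarrow> (nat \<Rightarrow> real) \<Rightarrow> real \<Rightarrow> real" where
  "boot_S B e c = sqrt (1 / real B * (\<Sum>b<B. (e b - c)\<^sup>2))"

end

theory Submission
  imports Defs
begin

text \<open>
  Put \<open>Z\<^sub>n = \<surd>n (\<psi>(P\<^sub>n) - \<psi>(P))\<close> and \<open>T\<^sub>b = \<surd>n (\<psi>\<^sub>b - \<psi>(P\<^sub>n))\<close>, where \<open>P\<^sub>n\<close> is the empirical
  distribution of the data and \<open>\<psi>\<^sub>b\<close> the estimate from resample \<open>b\<close>. Given the data, the \<open>T\<^sub>b\<close> are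
  independent, and each has the distribution \<open>F\<^sub>n\<close> which averages over all \<open>n\<^sup>n\<close> index maps. So the
  probability that \<open>(Z\<^sub>n, T\<^sub>1, \<dots>, T\<^sub>B)\<close> lies in a cuboid with sides \<open>J, I\<^sub>1, \<dots>, I\<^sub>B\<close> is the expectation
  of \<open>1(Z\<^sub>n \<in> J) F\<^sub>n(I\<^sub>1) \<dots> F\<^sub>n(I\<^sub>B)\<close>. The bootstrap hypothesis conditions on \<open>P\<^sub>n\<close> instead of the ordered
  data, but \<open>F\<^sub>n\<close> is symmetric in the observations, hence a measurable function of \<open>P\<^sub>n\<close>, and the
  hypothesis says that \<open>F\<^sub>n\<close> tends to the normal distribution in probability. The cuboid
  probabilities therefore tend to those of \<open>B + 1\<close> independent normal variables. An open set is a
  countable union of cuboids, so convergence carries over to the event that \<open>\<bar>Z\<^sub>n\<bar>\<close> is at most \<open>t\<close>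
  times the root mean square of the \<open>T\<^sub>b\<close>, whose boundary is null in the limit. The limit is
  \<open>1 - \<alpha>\<close> because the ratio of a normal variable to the root mean square of \<open>B\<close> others, all
  independent with the same variance, is Student distributed.
\<close>

section \<open>The Student distribution\<close>

text \<open>The obstacle is that \<open>D\<close> is an arbitrary measurable space and that \<psi>
  is known to be measurable only as a function of the sample. No regular conditional distribution
  can be assumed to exist, and \<psi> cannot be treated as a measurable function on the space of
  probability measures. Averaging over index maps avoids both problems: it makes the resampling law
  an explicit measurable function of the ordered data.

  Passing to the coarser sigma-algebra of the empirical distribution then needs an argument that
  works without any structure on \<open>D\<close>. The permuted copies of the sample that fall into
  an event are counted. For rectangles the empirical frequencies determine this count, and for a
  symmetric event it is either n! or 0.

  No joint limit of \<open>Z n\<close> and the resampling law has to be found, although the two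
  depend on each other: the law tends to a constant, which decouples it from \<open>Z n\<close>.
  Since all resamples share this law, the hypothesis on the single resample \<open>b0\<close>
  reaches all \<open>B\<close> of them.\<close>

lemma space_centered_normal [simp]: "space (centered_normal \<sigma>) = UNIV"
  and sets_centered_normal [simp, measurable_cong]: "sets (centered_normal \<sigma>) = sets borel"
  by (simp_all add: centered_normal_def)

lemma prob_space_centered_normal: "0 < \<sigma> \<Longrightarrow> prob_space (centered_normal \<sigma>)"
  unfolding centered_normal_def by (rule prob_space_normal_density)

lemma emeasure_centered_normal_singleton [simp]: "emeasure (centered_normal \<sigma>) {x} = 0"
proof -
  have "{x} \<in> null_sets (density lborel (\<lambda>y. ennreal (normal_density 0 \<sigma> y)))"
    by (intro absolutely_continuousI_density[unfolded absolutely_continuous_def, THEN subsetD]) auto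
  then show ?thesis
    by (simp add: centered_normal_def null_sets_def)
qed

section \<open>Gaussian integrals under an exponential tilt\<close>

lemma nn_integral_normal_density:
  assumes "0 < \<sigma>" shows "(\<integral>\<^sup>+x. ennreal (normal_density 0 \<sigma> x) \<partial>lborel) = 1"
  using assms by (simp add: nn_integral_eq_integral)

lemma nn_integral_centered_normal:
  assumes [measurable]: "f \<in> borel_measurable borel"
  shows "(\<integral>\<^sup>+x. f x \<partial>centered_normal \<sigma>) = (\<integral>\<^sup>+x. ennreal (normal_density 0 \<sigma> x) * f x \<partial>lborel)"
  unfolding centered_normal_def by (subst nn_integral_density) auto

text \<open>The factor adds 2c to the precision 1 / \<sigma>^2, so up to normalisation it changes
  the standard deviation from \<sigma> to \<tau>\<sigma>. Substituting \<open>\<tau> * x\<close>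
  restores the original density, and only the Jacobian \<tau> remains.\<close>

lemma nn_integral_centered_normal_tilt:
  assumes \<sigma>: "0 < \<sigma>" and c: "0 \<le> c" and [measurable]: "h \<in> borel_measurable borel"
  defines "\<tau> \<equiv> 1 / sqrt (1 + 2 * c * \<sigma>\<^sup>2)"
  shows "(\<integral>\<^sup>+x. ennreal (exp (- c * x\<^sup>2)) * h x \<partial>centered_normal \<sigma>)
       = ennreal \<tau> * (\<integral>\<^sup>+x. h (\<tau> * x) \<partial>centered_normal \<sigma>)"
proof -
  have pos: "0 < 1 + 2 * c * \<sigma>\<^sup>2" using c by (simp add: add_pos_nonneg)
  then have \<tau>: "0 < \<tau>" by (simp add: \<tau>_def)
  have \<tau>2: "\<tau>\<^sup>2 = 1 / (1 + 2 * c * \<sigma>\<^sup>2)"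
    using pos by (simp add: \<tau>_def power_divide)
  have e: "exp (- c * (\<tau> * x)\<^sup>2) * normal_density 0 \<sigma> (\<tau> * x) = normal_density 0 \<sigma> x" for x
  proof -
    have "- c * (\<tau> * x)\<^sup>2 + - (\<tau> * x)\<^sup>2 / (2 * \<sigma>\<^sup>2)
        = - ((1 + 2 * c * \<sigma>\<^sup>2) * \<tau>\<^sup>2) * x\<^sup>2 / (2 * \<sigma>\<^sup>2)"
      using \<sigma> by (simp add: power_mult_distrib field_simps)
    also have "\<dots> = - x\<^sup>2 / (2 * \<sigma>\<^sup>2)"
      using pos by (simp add: \<tau>2)
    finally have "- c * (\<tau> * x)\<^sup>2 + - (\<tau> * x)\<^sup>2 / (2 * \<sigma>\<^sup>2) = - x\<^sup>2 / (2 * \<sigma>\<^sup>2)" .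
    then show ?thesis
      by (simp add: normal_density_def flip: exp_add)
  qed
  have "(\<integral>\<^sup>+x. ennreal (exp (- c * x\<^sup>2)) * h x \<partial>centered_normal \<sigma>)
      = (\<integral>\<^sup>+x. ennreal (exp (- c * x\<^sup>2) * normal_density 0 \<sigma> x) * h x \<partial>lborel)"
    by (subst nn_integral_centered_normal) (auto simp: ennreal_mult' mult_ac)
  also have "\<dots> = ennreal \<tau> * (\<integral>\<^sup>+x. ennreal (exp (- c * (\<tau> * x)\<^sup>2) * normal_density 0 \<sigma> (\<tau> * x)) * h (\<tau> * x) \<partial>lborel)"
    using \<tau> by (subst nn_integral_real_affine[where c = \<tau> and t = 0]) auto
  also have "\<dots> = ennreal \<tau> * (\<integral>\<^sup>+x. h (\<tau> * x) \<partial>centered_normal \<sigma>)"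
    unfolding e by (subst nn_integral_centered_normal) auto
  finally show ?thesis .
qed

lemma product_prob_space_centered_normal:
  "0 < \<sigma> \<Longrightarrow> product_prob_space (\<lambda>_. centered_normal \<sigma>)"
  by (intro product_prob_spaceI prob_space_centered_normal)

text \<open>\<open>h\<close> need not factor over the coordinates, so the identity is proved between
  measures. The exponential splits over the coordinates, the one-dimensional tilt settles every box,
  and boxes determine a finite measure.\<close>

lemma nn_integral_PiM_centered_normal_tilt:
  fixes I :: "'i set"
  assumes \<sigma>: "0 < \<sigma>" and c: "0 \<le> c" and I: "finite I"
    and h [measurable]: "h \<in> borel_measurable (PiM I (\<lambda>_. borel))"
  defines "\<tau> \<equiv> 1 / sqrt (1 + 2 * c * \<sigma>\<^sup>2)"
  shows "(\<integral>\<^sup>+y. ennreal (exp (- c * (\<Sum>i\<in>I. (y i)\<^sup>2))) * h y \<partial>PiM I (\<lambda>_. centered_normal \<sigma>))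
       = ennreal \<tau> ^ card I * (\<integral>\<^sup>+y. h (\<lambda>i\<in>I. \<tau> * y i) \<partial>PiM I (\<lambda>_. centered_normal \<sigma>))"
proof -
  interpret N: product_prob_space "\<lambda>_ :: 'i. centered_normal \<sigma>"
    by (rule product_prob_space_centered_normal[OF \<sigma>])
  have NI: "prob_space (PiM I (\<lambda>_. centered_normal \<sigma>))"
    by (intro prob_space_PiM prob_space_centered_normal \<sigma>)
  let ?N = "PiM I (\<lambda>_. centered_normal \<sigma>)"
  let ?e = "\<lambda>y. ennreal (exp (- c * (\<Sum>i\<in>I. (y i)\<^sup>2)))"
  let ?L = "density ?N ?e"
  let ?R = "scale_measure (ennreal \<tau> ^ card I) (distr ?N (PiM I (\<lambda>_. borel)) (\<lambda>y. \<lambda>i\<in>I. \<tau> * y i))"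
  have sets [measurable_cong]: "sets ?N = sets (PiM I (\<lambda>_. borel))"
    by (intro sets_PiM_cong) auto
  have e_prod: "?e y = (\<Prod>i\<in>I. ennreal (exp (- c * (y i)\<^sup>2)))" for y
    using I by (simp add: prod_ennreal sum_distrib_left exp_sum)
  have "?L = ?R"
  proof (rule measure_eqI_PiM_finite[where M = "\<lambda>_. borel" and A = "\<lambda>_. space (PiM I (\<lambda>_. borel))"])
    show "sets ?L = sets (PiM I (\<lambda>_. borel))" by (simp add: sets)
    show "sets ?R = sets (PiM I (\<lambda>_. borel))" by simp
  next
    fix A :: "'i \<Rightarrow> real set" assume A: "\<And>i. i \<in> I \<Longrightarrow> A i \<in> sets borel"
    then have [measurable]: "Pi\<^sub>E I A \<in> sets (PiM I (\<lambda>_. borel))"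
      using I by (intro sets_PiM_I_finite) auto
    then have PA: "Pi\<^sub>E I A \<in> sets ?N" by (simp only: sets)
    have "emeasure ?L (Pi\<^sub>E I A) = (\<integral>\<^sup>+y. ?e y * indicator (Pi\<^sub>E I A) y \<partial>?N)"
      by (subst emeasure_density[OF _ PA]) auto
    also have "\<dots> = (\<integral>\<^sup>+y. (\<Prod>i\<in>I. ennreal (exp (- c * (y i)\<^sup>2)) * indicator (A i) (y i)) \<partial>?N)"
    proof (rule nn_integral_cong)
      fix y assume "y \<in> space ?N"
      then have "y \<in> extensional I" by (simp add: space_PiM PiE_def)
      then have "indicator (Pi\<^sub>E I A) y = (\<Prod>i\<in>I. indicator (A i) (y i) :: ennreal)"
        using I by (auto simp: indicator_def PiE_iff)
      then show "?e y * indicator (Pi\<^sub>E I A) y = (\<Prod>i\<in>I. ennreal (exp (- c * (y i)\<^sup>2)) * indicator (A i) (y i))"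
        unfolding e_prod by (simp add: prod.distrib)
    qed
    also have "\<dots> = (\<Prod>i\<in>I. \<integral>\<^sup>+x. ennreal (exp (- c * x\<^sup>2)) * indicator (A i) x \<partial>centered_normal \<sigma>)"
      using A I by (intro N.product_nn_integral_prod) auto
    also have "\<dots> = (\<Prod>i\<in>I. ennreal \<tau> * emeasure (centered_normal \<sigma>) {x. \<tau> * x \<in> A i})"
    proof (rule prod.cong[OF refl])
      fix i assume "i \<in> I"
      then have [measurable]: "A i \<in> sets borel" by (rule A)
      have [measurable]: "{x. \<tau> * x \<in> A i} \<in> sets borel"
        using measurable_sets[of "\<lambda>x. \<tau> * x" borel borel "A i"] by (simp add: vimage_def)
      have "(\<integral>\<^sup>+x. ennreal (exp (- c * x\<^sup>2)) * indicator (A i) x \<partial>centered_normal \<sigma>)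
          = ennreal \<tau> * (\<integral>\<^sup>+x. indicator (A i) (\<tau> * x) \<partial>centered_normal \<sigma>)"
        unfolding \<tau>_def using \<sigma> c by (intro nn_integral_centered_normal_tilt) auto
      also have "(\<integral>\<^sup>+x. indicator (A i) (\<tau> * x) \<partial>centered_normal \<sigma>)
          = (\<integral>\<^sup>+x. indicator {x. \<tau> * x \<in> A i} x \<partial>centered_normal \<sigma>)"
        by (simp add: indicator_def)
      also have "\<dots> = emeasure (centered_normal \<sigma>) {x. \<tau> * x \<in> A i}"
        by (rule nn_integral_indicator) simp
      finally show "(\<integral>\<^sup>+x. ennreal (exp (- c * x\<^sup>2)) * indicator (A i) x \<partial>centered_normal \<sigma>)
          = ennreal \<tau> * emeasure (centered_normal \<sigma>) {x. \<tau> * x \<in> A i}" .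
    qed
    also have "\<dots> = ennreal \<tau> ^ card I * (\<Prod>i\<in>I. emeasure (centered_normal \<sigma>) {x. \<tau> * x \<in> A i})"
      by (simp add: prod.distrib)
    also have "(\<Prod>i\<in>I. emeasure (centered_normal \<sigma>) {x. \<tau> * x \<in> A i})
        = emeasure ?N (Pi\<^sub>E I (\<lambda>i. {x. \<tau> * x \<in> A i}))"
    proof (rule N.emeasure_PiM[symmetric, OF I])
      fix i assume "i \<in> I"
      then show "{x. \<tau> * x \<in> A i} \<in> sets (centered_normal \<sigma>)"
        using measurable_sets[of "\<lambda>x. \<tau> * x" borel borel "A i"] A by (simp add: vimage_def)
    qed
    also have "Pi\<^sub>E I (\<lambda>i. {x. \<tau> * x \<in> A i}) = (\<lambda>y. \<lambda>i\<in>I. \<tau> * y i) -` Pi\<^sub>E I A \<inter> space ?N"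
      by (auto simp: space_PiM PiE_iff)
    also have "ennreal \<tau> ^ card I * emeasure ?N \<dots> = emeasure ?R (Pi\<^sub>E I A)"
      by (subst emeasure_scale_measure, subst emeasure_distr) auto
    finally show "emeasure ?L (Pi\<^sub>E I A) = emeasure ?R (Pi\<^sub>E I A)" .
  next
    show "range (\<lambda>_. space (PiM I (\<lambda>_. borel))) \<subseteq> prod_algebra I (\<lambda>_. borel :: real measure)"
      using I by (auto simp: space_PiM intro!: prod_algebraI_finite)
  next
    fix i :: nat
    \<comment> \<open>The whole space serves as a constant exhausting sequence, which requires
      finite mass; the exponential is at most 1 because \<open>0 \<le> c\<close>.\<close>
    have "emeasure ?L (space (PiM I (\<lambda>_. borel))) = (\<integral>\<^sup>+y. ?e y * indicator (space (PiM I (\<lambda>_. borel))) y \<partial>?N)"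
      by (subst emeasure_density) (auto simp: sets)
    also have "\<dots> \<le> (\<integral>\<^sup>+y. 1 \<partial>?N)"
      using c by (intro nn_integral_mono) (auto simp: indicator_def intro!: mult_nonneg_nonneg sum_nonneg)
    also have "\<dots> = 1" by (simp add: prob_space.emeasure_space_1[OF NI])
    finally show "emeasure ?L (space (PiM I (\<lambda>_. borel))) \<noteq> \<infinity>" by (auto simp: top_unique)
  qed (use I in auto)
  then have "(\<integral>\<^sup>+y. h y \<partial>?L) = (\<integral>\<^sup>+y. h y \<partial>?R)" by simp
  then show ?thesis
    by (simp add: nn_integral_density nn_integral_scale_measure nn_integral_distr)
qed

text \<open>Deviations are taken about zero, not about their own mean. This is why the Student law
  below has \<open>B\<close> degrees of freedom and not \<open>B - 1\<close>.\<close>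

definition rms :: "nat \<Rightarrow> (nat \<Rightarrow> real) \<Rightarrow> real" where
  "rms B y = sqrt (1 / real B * (\<Sum>b<B. (y b)\<^sup>2))"

lemma rms_nonneg [simp]: "0 \<le> rms B y"
  by (simp add: rms_def sum_nonneg)

lemma borel_measurable_rms [measurable]: "rms B \<in> borel_measurable (PiM {..<B} (\<lambda>_. borel))"
  unfolding rms_def[abs_def] by measurable

lemma rms_mult: "0 \<le> c \<Longrightarrow> rms B (\<lambda>b. c * y b) = c * rms B y"
  by (simp add: rms_def power_mult_distrib real_sqrt_mult real_sqrt_divide flip: sum_distrib_left)

lemma rms_cong: "(\<And>b. b < B \<Longrightarrow> y b = z b) \<Longrightarrow> rms B y = rms B z"
  by (simp add: rms_def)

lemma rms_restrict_mult: "0 \<le> c \<Longrightarrow> rms B (\<lambda>b\<in>{..<B}. c * y b) = c * rms B y"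
  by (subst rms_mult[symmetric]) (auto intro: rms_cong)

text \<open>Expand the power as a Gamma integral over \<open>w\<close> and integrate the Gaussian in \<open>u\<close> first.\<close>

lemma nn_integral_student_t_kernel:
  assumes B: "1 \<le> B"
  shows "(\<integral>\<^sup>+u. ennreal ((1 + u\<^sup>2 / real B) powr (- (real B + 1) / 2)) \<partial>lborel)
       = ennreal (sqrt (real B * pi) * Gamma (real B / 2) / Gamma ((real B + 1) / 2))"
proof -
  \<comment> \<open>The kernel is a power with exponent -a. Integrating out \<open>u\<close> costs
    half a power of \<open>w\<close>, which leaves the Gamma integral at a - 1/2 = B / 2.\<close>
  define a where "a = (real B + 1) / 2"
  have a: "0 < a" "a - 1/2 = real B / 2" by (simp_all add: a_def field_simps)
  have Ba: "0 < real B" using B by simp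
  let ?G = "\<lambda>w u. ennreal (indicator {0<..} w * w powr (a - 1) * exp (- w * (1 + u\<^sup>2 / real B)))"
  have Gam: "ennreal (Gamma s) = (\<integral>\<^sup>+t. ennreal (indicator {0<..} t * t powr (s - 1) * exp (- t)) \<partial>lborel)"
    if "0 < s" for s :: real
    unfolding Gamma_conv_nn_integral_real[OF that]
    by (rule nn_integral_cong_AE, rule AE_I[where N = "{0}"]) (auto simp: indicator_def exp_minus field_simps)
  \<comment> \<open>Scaling the variable of the Gamma integral by r = 1 + u^2 / B produces the power
    r^(-a).\<close>
  have inner_w: "(\<integral>\<^sup>+w. ?G w u \<partial>lborel) = ennreal (Gamma a) * ennreal ((1 + u\<^sup>2 / real B) powr (- a))" for u
  proof -
    define r where "r = 1 + u\<^sup>2 / real B"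
    have r: "0 < r" unfolding r_def using Ba by (simp add: add_pos_nonneg)
    have "ennreal (Gamma a) = ennreal r * (\<integral>\<^sup>+w. ennreal (indicator {0<..} (r * w) * (r * w) powr (a - 1) * exp (- (r * w))) \<partial>lborel)"
      unfolding Gam[OF a(1)] using r by (subst nn_integral_real_affine[where c = r and t = 0]) auto
    also have "\<dots> = (\<integral>\<^sup>+w. ennreal (r powr a) * ?G w u \<partial>lborel)"
    proof (subst nn_integral_cmult[symmetric], simp, rule nn_integral_cong)
      fix w :: real
      have "r * (indicator {0<..} (r * w) * (r * w) powr (a - 1) * exp (- (r * w)))
          = r powr a * (indicator {0<..} w * w powr (a - 1) * exp (- w * (1 + u\<^sup>2 / real B)))"
        using r by (cases "0 < w")
          (auto simp: powr_mult powr_diff zero_less_mult_iff mult_ac simp flip: r_def)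
      then show "ennreal r * ennreal (indicator {0<..} (r * w) * (r * w) powr (a - 1) * exp (- (r * w)))
          = ennreal (r powr a) * ?G w u"
        using r by (simp flip: ennreal_mult')
    qed
    also have "\<dots> = ennreal (r powr a) * (\<integral>\<^sup>+w. ?G w u \<partial>lborel)"
      by (rule nn_integral_cmult) simp
    finally have "ennreal (Gamma a) * ennreal (r powr (- a))
        = ennreal (r powr (- a)) * ennreal (r powr a) * (\<integral>\<^sup>+w. ?G w u \<partial>lborel)"
      by (simp add: mult_ac)
    also have "ennreal (r powr (- a)) * ennreal (r powr a) = 1"
      using r by (simp flip: ennreal_mult' powr_add)
    finally show ?thesis by (simp add: r_def)
  qed
  have inner_u: "(\<integral>\<^sup>+u. ?G w u \<partial>lborel)
      = ennreal (sqrt (real B * pi)) * ennreal (indicator {0<..} w * w powr (a - 1/2 - 1) * exp (- w))" for w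
  proof (cases "0 < w")
    case True
    \<comment> \<open>As a function of \<open>u\<close>, exp (- w u^2 / B) is an unnormalised normal
      density with variance B / (2w).\<close>
    define s where "s = sqrt (real B / (2 * w))"
    have s: "0 < s" "s\<^sup>2 = real B / (2 * w)" using True Ba by (simp_all add: s_def)
    have "sqrt (2 * pi * s\<^sup>2) = sqrt (real B * pi) * w powr (- 1/2)"
    proof -
      have "sqrt (2 * pi * s\<^sup>2) = sqrt (real B * pi / w)" using s True by (simp add: field_simps)
      also have "\<dots> = sqrt (real B * pi) * w powr (- 1/2)"
        using True by (simp add: real_sqrt_divide powr_minus_divide powr_half_sqrt)
      finally show ?thesis .
    qed
    then have nd: "normal_density 0 s u = w powr (1/2) / sqrt (real B * pi) * exp (- w * (u\<^sup>2 / real B))" for u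
      using True Ba unfolding normal_density_def
      by (simp add: s(2) powr_minus_divide field_simps)
    have eq: "w powr (a - 1) * exp (- w * (1 + u\<^sup>2 / real B))
        = (sqrt (real B * pi) * (w powr (a - 1/2 - 1) * exp (- w))) * normal_density 0 s u" for u
    proof -
      have "w powr (a - 1) = w powr (a - 1/2 - 1) * w powr (1/2)"
        by (simp flip: powr_add)
      moreover have "exp (- w * (1 + u\<^sup>2 / real B)) = exp (- w) * exp (- w * (u\<^sup>2 / real B))"
        by (simp add: algebra_simps flip: exp_add)
      ultimately show ?thesis using Ba by (simp add: nd)
    qed
    have "(\<integral>\<^sup>+u. ?G w u \<partial>lborel)
        = (\<integral>\<^sup>+u. ennreal (sqrt (real B * pi) * (w powr (a - 1/2 - 1) * exp (- w))) * ennreal (normal_density 0 s u) \<partial>lborel)"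
    proof (rule nn_integral_cong)
      fix u :: real
      show "?G w u = ennreal (sqrt (real B * pi) * (w powr (a - 1/2 - 1) * exp (- w))) * ennreal (normal_density 0 s u)"
        unfolding ennreal_mult''[OF normal_density_nonneg, symmetric] eq[symmetric] using True by simp
    qed
    also have "\<dots> = ennreal (sqrt (real B * pi) * (w powr (a - 1/2 - 1) * exp (- w)))"
      using s by (subst nn_integral_cmult) (auto simp: nn_integral_normal_density)
    finally show ?thesis using True by (simp flip: ennreal_mult')
  qed simp
  have "ennreal (Gamma a) * (\<integral>\<^sup>+u. ennreal ((1 + u\<^sup>2 / real B) powr (- a)) \<partial>lborel)
      = (\<integral>\<^sup>+u. \<integral>\<^sup>+w. ?G w u \<partial>lborel \<partial>lborel)"
    unfolding inner_w by (subst nn_integral_cmult) auto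
  also have "\<dots> = (\<integral>\<^sup>+w. \<integral>\<^sup>+u. ?G w u \<partial>lborel \<partial>lborel)"
    by (rule lborel_pair.Fubini') measurable
  also have "\<dots> = ennreal (sqrt (real B * pi)) * ennreal (Gamma (real B / 2))"
    unfolding inner_u using Ba by (subst nn_integral_cmult) (auto simp: Gam a(2))
  finally have *: "ennreal (Gamma a) * (\<integral>\<^sup>+u. ennreal ((1 + u\<^sup>2 / real B) powr (- a)) \<partial>lborel)
      = ennreal (sqrt (real B * pi)) * ennreal (Gamma (real B / 2))" .
  have Gp: "0 < Gamma a" using a by (intro Gamma_real_pos)
  have "(\<integral>\<^sup>+u. ennreal ((1 + u\<^sup>2 / real B) powr (- a)) \<partial>lborel)
      = ennreal (1 / Gamma a) * (ennreal (Gamma a) * (\<integral>\<^sup>+u. ennreal ((1 + u\<^sup>2 / real B) powr (- a)) \<partial>lborel))"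
    using Gp by (simp add: mult.assoc[symmetric] flip: ennreal_mult')
  also have "\<dots> = ennreal (sqrt (real B * pi) * Gamma (real B / 2) / Gamma a)"
    unfolding * using Gp by (simp add: ennreal_mult'[symmetric])
  finally show ?thesis by (simp only: a_def minus_divide_left)
qed

text \<open>A single coordinate suffices: it is nonzero almost surely, and \<open>1 \<le> B\<close>
  provides it. Division by \<open>rms\<close> is therefore harmless.\<close>

lemma AE_rms_pos:
  assumes \<sigma>: "0 < \<sigma>" and B: "1 \<le> B"
  shows "AE y in PiM {..<B} (\<lambda>_. centered_normal \<sigma>). 0 < rms B y"
proof -
  have "AE x in centered_normal \<sigma>. x \<noteq> 0"
    by (rule AE_I[where N = "{0}"]) auto
  then have "AE y in PiM {..<B} (\<lambda>_. centered_normal \<sigma>). y 0 \<noteq> 0"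
    using B \<sigma> by (intro AE_PiM_component prob_space_centered_normal) auto
  then show ?thesis
  proof eventually_elim
    case (elim y)
    then have "0 < (\<Sum>b<B. (y b)\<^sup>2)"
      using B by (intro sum_pos2[where i = 0]) auto
    then show ?case using B by (simp add: rms_def)
  qed
qed

text \<open>Substituting \<open>z = u * rms B y\<close> for fixed \<open>y\<close> gives the ratio the density
  \<open>g u = E (rms B y * \<phi> (u * rms B y))\<close>. The factor \<open>\<phi>\<close> only rescales the normal law of \<open>y\<close>, which
  yields \<open>g u = g 0 * (1 + u\<^sup>2 / B) powr (- (B + 1) / 2)\<close>; the total mass determines \<open>g 0\<close>.\<close>

theorem distr_normal_over_rms:
  assumes \<sigma>: "0 < \<sigma>" and B: "1 \<le> B"
  shows "distr (centered_normal \<sigma> \<Otimes>\<^sub>M PiM {..<B} (\<lambda>_. centered_normal \<sigma>)) borel (\<lambda>(z, y). z / rms B y)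
       = student_t B"
proof -
  let ?N = "centered_normal \<sigma>" and ?P = "PiM {..<B} (\<lambda>_. centered_normal \<sigma>)"
  interpret N: prob_space ?N by (rule prob_space_centered_normal[OF \<sigma>])
  interpret P: prob_space ?P by (intro prob_space_PiM prob_space_centered_normal \<sigma>)
  interpret PL: pair_sigma_finite ?P lborel ..
  interpret PN: pair_prob_space ?N ?P ..
  have sets [measurable_cong]: "sets ?P = sets (PiM {..<B} (\<lambda>_. borel))"
    by (intro sets_PiM_cong) auto
  have Ba: "0 < real B" using B by simp
  define s where "s u = (1 + u\<^sup>2 / real B) powr (- (real B + 1) / 2)" for u :: real
  have [measurable]: "s \<in> borel_measurable borel" unfolding s_def by measurable
  define g where "g u = (\<integral>\<^sup>+y. ennreal (normal_density 0 \<sigma> (u * rms B y)) * ennreal (rms B y) \<partial>?P)" for u :: real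
  have g: "g u = ennreal (s u) * g 0" for u
  proof -
    \<comment> \<open>Chosen so that the normal density at \<open>u * rms B y\<close> is its value
      at 0 times exp (- c S), where S is the sum of the squares of \<open>y\<close>.\<close>
    define c where "c = u\<^sup>2 / (2 * \<sigma>\<^sup>2 * real B)"
    define \<tau> where "\<tau> = 1 / sqrt (1 + 2 * c * \<sigma>\<^sup>2)"
    define H where "H y = ennreal (normal_density 0 \<sigma> 0) * ennreal (rms B y)" for y
    have [measurable]: "H \<in> borel_measurable (PiM {..<B} (\<lambda>_. borel))" unfolding H_def by measurable
    have c0: "0 \<le> c" by (simp add: c_def)
    have r: "1 + 2 * c * \<sigma>\<^sup>2 = 1 + u\<^sup>2 / real B" using \<sigma> Ba by (simp add: c_def)
    have pos: "0 < 1 + u\<^sup>2 / real B" using Ba by (simp add: add_pos_nonneg)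
    then have \<tau>0: "0 \<le> \<tau>" by (simp add: \<tau>_def r)
    \<comment> \<open>The tilt contributes one factor \<tau> for each of the \<open>B\<close>
      coordinates, and the homogeneity of \<open>rms\<close> in the Jacobian one more. Hence the
      exponent B + 1.\<close>
    have \<tau>s: "\<tau> ^ (B + 1) = s u"
    proof -
      have "\<tau> = (1 + u\<^sup>2 / real B) powr (- 1/2)"
        using pos by (simp add: \<tau>_def r powr_minus_divide powr_half_sqrt)
      then have "\<tau> ^ (B + 1) = (1 + u\<^sup>2 / real B) powr (- 1/2 * real (B + 1))"
        using pos by (simp only: powr_powr powr_realpow[symmetric] powr_gt_zero)
      also have "- 1/2 * real (B + 1) = - (real B + 1) / 2" by (simp add: field_simps)
      finally show ?thesis by (simp only: s_def)
    qed
    have "normal_density 0 \<sigma> (u * rms B y) = exp (- c * (\<Sum>b<B. (y b)\<^sup>2)) * normal_density 0 \<sigma> 0" for y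
    proof -
      have "(rms B y)\<^sup>2 = (\<Sum>b<B. (y b)\<^sup>2) / real B"
        by (simp add: rms_def sum_nonneg)
      then have "- (u * rms B y)\<^sup>2 / (2 * \<sigma>\<^sup>2) = - c * (\<Sum>b<B. (y b)\<^sup>2)"
        unfolding c_def power_mult_distrib by simp
      then show ?thesis
        by (simp add: normal_density_def)
    qed
    then have "g u = (\<integral>\<^sup>+y. ennreal (exp (- c * (\<Sum>b<B. (y b)\<^sup>2))) * H y \<partial>?P)"
      by (simp add: g_def H_def ennreal_mult' mult.assoc)
    also have "\<dots> = ennreal \<tau> ^ card {..<B} * (\<integral>\<^sup>+y. H (\<lambda>b\<in>{..<B}. \<tau> * y b) \<partial>?P)"
      unfolding \<tau>_def by (rule nn_integral_PiM_centered_normal_tilt[OF \<sigma> c0]) auto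
    also have "(\<integral>\<^sup>+y. H (\<lambda>b\<in>{..<B}. \<tau> * y b) \<partial>?P) = (\<integral>\<^sup>+y. ennreal \<tau> * H y \<partial>?P)"
      using \<tau>0 by (simp add: H_def rms_restrict_mult ennreal_mult' mult_ac)
    also have "\<dots> = ennreal \<tau> * (\<integral>\<^sup>+y. H y \<partial>?P)"
      by (rule nn_integral_cmult) measurable
    also have "(\<integral>\<^sup>+y. H y \<partial>?P) = g 0"
      by (simp add: g_def H_def)
    finally show ?thesis
      using \<tau>0 by (simp add: mult.assoc[symmetric] ennreal_power flip: \<tau>s ennreal_mult' power_Suc2)
  qed
  have law: "emeasure (distr (?N \<Otimes>\<^sub>M ?P) borel (\<lambda>(z, y). z / rms B y)) A
      = (\<integral>\<^sup>+u. g 0 * ennreal (s u) * indicator A u \<partial>lborel)"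
    if [measurable]: "A \<in> sets borel" for A
  proof -
    have "emeasure (distr (?N \<Otimes>\<^sub>M ?P) borel (\<lambda>(z, y). z / rms B y)) A
        = (\<integral>\<^sup>+x. indicator A x \<partial>distr (?N \<Otimes>\<^sub>M ?P) borel (\<lambda>(z, y). z / rms B y))"
      by simp
    also have "\<dots> = (\<integral>\<^sup>+x. indicator A (fst x / rms B (snd x)) \<partial>(?N \<Otimes>\<^sub>M ?P))"
      by (subst nn_integral_distr) (auto simp: case_prod_beta)
    also have "\<dots> = (\<integral>\<^sup>+y. \<integral>\<^sup>+z. indicator A (z / rms B y) \<partial>?N \<partial>?P)"
      by (subst PN.nn_integral_snd[symmetric]) auto
    also have "\<dots> = (\<integral>\<^sup>+y. \<integral>\<^sup>+u. ennreal (normal_density 0 \<sigma> (u * rms B y)) * ennreal (rms B y) * indicator A u \<partial>lborel \<partial>?P)"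
    proof (rule nn_integral_cong_AE)
      show "AE y in ?P. (\<integral>\<^sup>+z. indicator A (z / rms B y) \<partial>?N)
          = (\<integral>\<^sup>+u. ennreal (normal_density 0 \<sigma> (u * rms B y)) * ennreal (rms B y) * indicator A u \<partial>lborel)"
        using AE_rms_pos[OF \<sigma> B]
      proof eventually_elim
        case (elim y)
        have "(\<integral>\<^sup>+z. indicator A (z / rms B y) \<partial>?N)
            = (\<integral>\<^sup>+z. ennreal (normal_density 0 \<sigma> z) * indicator A (z / rms B y) \<partial>lborel)"
          by (subst nn_integral_centered_normal) auto
        also have "\<dots> = ennreal (rms B y) * (\<integral>\<^sup>+u. ennreal (normal_density 0 \<sigma> (rms B y * u)) * indicator A (rms B y * u / rms B y) \<partial>lborel)"
          using elim by (subst nn_integral_real_affine[where c = "rms B y" and t = 0]) auto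
        also have "\<dots> = (\<integral>\<^sup>+u. ennreal (rms B y) * (ennreal (normal_density 0 \<sigma> (rms B y * u)) * indicator A u) \<partial>lborel)"
          using elim by (subst nn_integral_cmult) auto
        finally show ?case by (simp add: mult_ac)
      qed
    qed
    also have "\<dots> = (\<integral>\<^sup>+u. \<integral>\<^sup>+y. ennreal (normal_density 0 \<sigma> (u * rms B y)) * ennreal (rms B y) * indicator A u \<partial>?P \<partial>lborel)"
      by (rule PL.Fubini'[symmetric]) measurable
    also have "\<dots> = (\<integral>\<^sup>+u. g u * indicator A u \<partial>lborel)"
      unfolding g_def by (subst nn_integral_multc) auto
    also have "\<dots> = (\<integral>\<^sup>+u. g 0 * ennreal (s u) * indicator A u \<partial>lborel)"
      by (subst g) (simp only: mult_ac)
    finally show ?thesis .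
  qed
  define K where "K = sqrt (real B * pi) * Gamma (real B / 2) / Gamma ((real B + 1) / 2)"
  have K: "0 < K" using Ba by (auto simp: K_def intro!: divide_pos_pos mult_pos_pos Gamma_real_pos)
  have "1 = emeasure (distr (?N \<Otimes>\<^sub>M ?P) borel (\<lambda>(z, y). z / rms B y)) UNIV"
    by (subst emeasure_distr) (use PN.emeasure_space_1 in auto)
  also have "\<dots> = g 0 * (\<integral>\<^sup>+u. ennreal (s u) \<partial>lborel)"
    by (simp add: law nn_integral_cmult)
  also have "(\<integral>\<^sup>+u. ennreal (s u) \<partial>lborel) = ennreal K"
    unfolding s_def K_def by (rule nn_integral_student_t_kernel[OF B])
  finally have "g 0 * ennreal K * ennreal (1 / K) = ennreal (1 / K)" by simp
  then have g0: "g 0 = ennreal (1 / K)"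
    using K by (simp add: mult.assoc flip: ennreal_mult')
  have t: "student_t_density B u = 1 / K * s u" for u
    by (simp add: student_t_density_def s_def K_def)
  show ?thesis
  proof (rule measure_eqI)
    fix A assume "A \<in> sets (distr (?N \<Otimes>\<^sub>M ?P) borel (\<lambda>(z, y). z / rms B y))"
    then have [measurable]: "A \<in> sets borel" by simp
    show "emeasure (distr (?N \<Otimes>\<^sub>M ?P) borel (\<lambda>(z, y). z / rms B y)) A = emeasure (student_t B) A"
      unfolding law[OF \<open>A \<in> sets borel\<close>] student_t_def t[abs_def] g0 using K
      by (subst emeasure_density) (auto intro!: nn_integral_cong simp: ennreal_mult'[symmetric])
  qed (simp add: student_t_def)
qed

section \<open>Symmetry and quantiles of the Student distribution\<close>

lemma student_t_density_minus: "student_t_density B (- x) = student_t_density B x"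
  by (simp add: student_t_density_def)

lemma borel_measurable_student_t_density [measurable]: "student_t_density B \<in> borel_measurable borel"
  unfolding student_t_density_def[abs_def] by measurable

lemma emeasure_student_t_singleton: "emeasure (student_t B) {x} = 0"
proof -
  have "{x} \<in> null_sets (density lborel (\<lambda>y. ennreal (student_t_density B y)))"
    by (intro absolutely_continuousI_density[unfolded absolutely_continuous_def, THEN subsetD]) auto
  then show ?thesis
    by (simp add: student_t_def null_sets_def)
qed

text \<open>The density is normalised because it is the law of a ratio of random variables. The
  standard deviation 1 is an arbitrary choice, as the law of the ratio does not depend on the
  scale.\<close>

lemma real_distribution_student_t:
  assumes "1 \<le> B" shows "real_distribution (student_t B)"
proof -
  have "distr (centered_normal 1 \<Otimes>\<^sub>M PiM {..<B} (\<lambda>_. centered_normal 1)) borel (\<lambda>(z, y). z / rms B y)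
       = student_t B"
    using assms by (intro distr_normal_over_rms) auto
  moreover have "prob_space (centered_normal 1 \<Otimes>\<^sub>M PiM {..<B} (\<lambda>_. centered_normal 1))"
    by (intro prob_space_pair prob_space_PiM prob_space_centered_normal) auto
  then have "prob_space (distr (centered_normal 1 \<Otimes>\<^sub>M PiM {..<B} (\<lambda>_. centered_normal 1)) borel (\<lambda>(z, y). z / rms B y))"
  proof (rule prob_space.prob_space_distr)
    have [measurable_cong]: "sets (PiM {..<B} (\<lambda>_. centered_normal 1)) = sets (PiM {..<B} (\<lambda>_. borel))"
      by (intro sets_PiM_cong) auto
    show "(\<lambda>(z, y). z / rms B y) \<in> borel_measurable (centered_normal 1 \<Otimes>\<^sub>M PiM {..<B} (\<lambda>_. centered_normal 1))"
      by measurable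
  qed
  ultimately show ?thesis
    by (auto simp: real_distribution_def real_distribution_axioms_def student_t_def)
qed

text \<open>Reflecting the density gives F (- x) = 1 - F x, and continuity makes the generalised
  inverse exact, F t = q. The interval has mass F t - F (- t).\<close>

lemma measure_student_t_symmetric_interval:
  assumes B: "1 \<le> B" and q: "1/2 < q" "q < 1"
  defines "t \<equiv> quantile (student_t B) q"
  shows "measure (student_t B) {- t..t} = 2 * q - 1"
proof -
  interpret S: real_distribution "student_t B" by (rule real_distribution_student_t[OF B])
  let ?F = "cdf (student_t B)"
  have null: "measure (student_t B) {x} = 0" for x
    by (simp add: measure_def emeasure_student_t_singleton)
  have cont: "isCont ?F x" for x
    by (simp add: S.isCont_cdf null)
  have refl: "measure (student_t B) {- x..} = ?F x" for x
  proof -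
    have "emeasure (student_t B) {- x..} = (\<integral>\<^sup>+u. ennreal (student_t_density B u) * indicator {- x..} u \<partial>lborel)"
      unfolding student_t_def by (subst emeasure_density) auto
    also have "\<dots> = (\<integral>\<^sup>+u. ennreal (student_t_density B u) * indicator {..x} u \<partial>lborel)"
      by (subst nn_integral_real_affine[where c = "-1" and t = 0])
        (auto simp: student_t_density_minus indicator_def intro!: nn_integral_cong)
    also have "\<dots> = emeasure (student_t B) {..x}"
      unfolding student_t_def by (subst emeasure_density) auto
    finally show ?thesis by (simp add: measure_def cdf_def)
  qed
  have minus: "?F (- x) = 1 - ?F x" for x
  proof -
    have "?F (- x) = measure (student_t B) {..<- x} + measure (student_t B) {- x}"
      unfolding cdf_def by (subst S.finite_measure_Union[symmetric]) (auto intro!: arg_cong[where f = "measure _"])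
    also have "measure (student_t B) {..<- x} = measure (student_t B) (space (student_t B) - {- x..})"
      by (intro arg_cong[where f = "measure _"]) auto
    also have "\<dots> = 1 - ?F x"
      by (subst S.prob_compl) (auto simp: refl)
    finally show ?thesis by (simp add: null)
  qed
  have "\<forall>\<^sub>F x in at_bot. ?F x < q"
    using S.cdf_lim_at_bot q by (intro order_tendstoD) auto
  then obtain l where l: "\<And>x. x \<le> l \<Longrightarrow> ?F x < q" by (meson eventually_at_bot_linorder)
  have "\<forall>\<^sub>F x in at_top. q < ?F x"
    using S.cdf_lim_at_top_prob q by (intro order_tendstoD) auto
  then obtain u where u: "\<And>x. u \<le> x \<Longrightarrow> q < ?F x" by (meson eventually_at_top_linorder)
  let ?Q = "{x. q \<le> ?F x}"
  \<comment> \<open>\<open>Inf\<close> has its usual meaning only for a nonempty set that is bounded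
    below. Both properties come from the limits of the distribution function at the two
    ends.\<close>
  have bdd: "bdd_below ?Q"
  proof (rule bdd_belowI)
    fix x assume "x \<in> ?Q"
    then have "\<not> x \<le> l" using l[of x] by auto
    then show "l \<le> x" by simp
  qed
  have ne: "?Q \<noteq> {}" using u[of u] by (auto intro!: exI[of _ u])
  have closed: "closed ?Q"
    using cont by (intro closed_Collect_le continuous_at_imp_continuous_on) auto
  have "t \<in> ?Q"
    unfolding t_def quantile_def by (rule closed_contains_Inf[OF ne bdd closed])
  \<comment> \<open>Otherwise continuity from the left would put a point smaller than
    \<open>t\<close> into the set whose infimum is \<open>t\<close>.\<close>
  moreover have "?F t \<le> q"
  proof (rule ccontr)
    assume "\<not> ?F t \<le> q"
    then have "\<forall>\<^sub>F x in at_left t. q < ?F x"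
      using cont[of t] by (intro order_tendstoD(1)[of _ "?F t"]) (auto simp: isCont_def filterlim_at_split)
    then obtain b where "b < t" and b: "\<And>y. b < y \<Longrightarrow> y < t \<Longrightarrow> q < ?F y"
      unfolding eventually_at_left_field by blast
    then obtain x where "x < t" "q < ?F x"
      using dense[of b t] by blast
    then show False
      using cInf_lower[OF _ bdd, of x] by (auto simp: t_def quantile_def)
  qed
  ultimately have Ft: "?F t = q" by simp
  \<comment> \<open>This is where \<open>1/2 < q\<close> enters: t \<le> 0 would give q \<le> 1 - q
    by monotonicity.\<close>
  have "- t < t"
  proof (rule ccontr)
    assume "\<not> - t < t"
    then have "?F t \<le> ?F (- t)" by (intro S.cdf_nondecreasing) auto
    then show False using q by (simp add: minus Ft)
  qed
  have "measure (student_t B) {- t..t} = measure (student_t B) {- t} + measure (student_t B) {- t<..t}"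
    using \<open>- t < t\<close> by (subst S.finite_measure_Union[symmetric]) (auto intro!: arg_cong[where f = "measure _"])
  also have "\<dots> = 2 * q - 1"
    using S.cdf_diff_eq[OF \<open>- t < t\<close>] by (simp add: null minus Ft)
  finally show ?thesis .
qed

section \<open>Convergence on cuboids\<close>

text \<open>Half-open sides have probabilities that are differences of distribution functions, and
  they make cuboids closed under intersection. Crossed corners are allowed and give the empty
  set.\<close>

definition cuboid :: "'i set \<Rightarrow> ('i \<Rightarrow> real) \<Rightarrow> ('i \<Rightarrow> real) \<Rightarrow> ('i \<Rightarrow> real) set" where
  "cuboid I a b = Pi\<^sub>E I (\<lambda>i. {a i<..b i})"

lemma sets_cuboid [measurable]: "finite I \<Longrightarrow> cuboid I a b \<in> sets (PiM I (\<lambda>_. borel))"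
  unfolding cuboid_def by (intro sets_PiM_I_finite) auto

lemma cuboid_Int:
  "cuboid I a b \<inter> cuboid I a' b' = cuboid I (\<lambda>i. max (a i) (a' i)) (\<lambda>i. min (b i) (b' i))"
  by (auto simp: cuboid_def PiE_iff)

text \<open>Rational corners keep the family countable. Openness refers to functions on the whole
  index type, hence the intersection with the extensional functions on \<open>I\<close>.\<close>

lemma open_eq_countable_Union_cuboid:
  fixes U :: "('i \<Rightarrow> real) set"
  assumes "open U" "finite I"
  shows "\<exists>\<F>. countable \<F> \<and> (\<forall>R\<in>\<F>. \<exists>a b. R = cuboid I a b) \<and> U \<inter> Pi\<^sub>E I (\<lambda>_. UNIV) = \<Union>\<F>"
proof -
  let ?Q = "Pi\<^sub>E I (\<lambda>_. \<rat> :: real set)"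
  let ?\<F> = "{R \<in> (\<lambda>(a, b). cuboid I a b) ` (?Q \<times> ?Q). R \<subseteq> U}"
  have "countable (?Q \<times> ?Q)"
    using \<open>finite I\<close> by (intro countable_SIGMA countable_PiE countable_rat)
  then have "countable ((\<lambda>(a, b). cuboid I a b) ` (?Q \<times> ?Q))" by (rule countable_image)
  then have "countable ?\<F>" by (rule countable_subset[OF Collect_restrict])
  moreover have "\<exists>a b. R = cuboid I a b" if "R \<in> ?\<F>" for R
    using that[THEN CollectD, THEN conjunct1] by (rule imageE) (auto simp: split_beta)
  moreover have "U \<inter> Pi\<^sub>E I (\<lambda>_. UNIV) = \<Union>?\<F>"
  proof (intro equalityI subsetI)
    fix y assume y: "y \<in> U \<inter> Pi\<^sub>E I (\<lambda>_. UNIV)"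
    have "openin (product_topology (\<lambda>_. euclidean) UNIV) U"
      using \<open>open U\<close> by (simp add: open_fun_def)
    moreover have "y \<in> U" using y by simp
    ultimately obtain W where
      W: "y \<in> Pi\<^sub>E UNIV W" "\<And>i. open (W i)" "Pi\<^sub>E UNIV W \<subseteq> U"
      using product_topology_open_contains_basis[of "\<lambda>_. euclidean" UNIV U y] by auto
    have "\<exists>a b. a \<in> \<rat> \<and> b \<in> \<rat> \<and> a < y i \<and> y i \<le> b \<and> {a<..b} \<subseteq> W i" for i
    proof -
      have "y i \<in> W i" using W(1) by auto
      then obtain e where e: "0 < e" "ball (y i) e \<subseteq> W i"
        using W(2) by (meson open_contains_ball)
      obtain a where a: "a \<in> \<rat>" "y i - e < a" "a < y i" using Rats_dense_in_real[of "y i - e" "y i"] e by auto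
      obtain b where b: "b \<in> \<rat>" "y i < b" "b < y i + e" using Rats_dense_in_real[of "y i" "y i + e"] e by auto
      have "{a<..b} \<subseteq> ball (y i) e" using a b by (auto simp: dist_real_def)
      then show ?thesis using a b e by (intro exI[of _ a] exI[of _ b]) auto
    qed
    then obtain a b where ab: "\<And>i. a i \<in> \<rat>" "\<And>i. b i \<in> \<rat>" "\<And>i. a i < y i" "\<And>i. y i \<le> b i"
      "\<And>i. {a i<..b i} \<subseteq> W i" by metis
    \<comment> \<open>The rational corners were found for every index of the type; cutting them down
      to \<open>I\<close> puts them into the countable set \<open>?Q \<times> ?Q\<close>.\<close>
    have eq: "cuboid I a b = cuboid I (restrict a I) (restrict b I)"
      unfolding cuboid_def by (intro PiE_cong) auto
    have "cuboid I a b \<subseteq> Pi\<^sub>E UNIV W"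
    proof
      fix z assume z: "z \<in> cuboid I a b"
      have "z i \<in> W i" for i
      proof (cases "i \<in> I")
        case True
        then show ?thesis using z ab(5)[of i] by (auto simp: cuboid_def PiE_iff)
      next
        \<comment> \<open>Outside \<open>I\<close> both functions are \<open>undefined\<close>, so
          \<open>z\<close> agrees there with \<open>y\<close>, which lies in the box.\<close>
        case False
        then have "z i = y i" using z y by (auto simp: cuboid_def PiE_iff extensional_def)
        then show ?thesis using W(1) by auto
      qed
      then show "z \<in> Pi\<^sub>E UNIV W" by auto
    qed
    moreover have "y \<in> cuboid I a b" using y ab(3,4) by (auto simp: cuboid_def PiE_iff)
    moreover have "cuboid I a b \<in> (\<lambda>(a, b). cuboid I a b) ` (?Q \<times> ?Q)"
      using ab(1,2) unfolding eq
      by (intro image_eqI[where x = "(restrict a I, restrict b I)"]) auto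
    ultimately show "y \<in> \<Union>?\<F>"
      using W(3) by (intro UnionI[of "cuboid I a b"] CollectI conjI) (assumption | rule subset_trans)+
  next
    fix y assume "y \<in> \<Union>?\<F>"
    then obtain R where R: "y \<in> R" "R \<in> ?\<F>" by (rule UnionE)
    obtain p where p: "R = cuboid I (fst p) (snd p)"
      using R(2)[THEN CollectD, THEN conjunct1] by (rule imageE) (simp add: split_beta)
    have "R \<subseteq> U" using R(2) by (simp only: mem_Collect_eq)
    then show "y \<in> U \<inter> Pi\<^sub>E I (\<lambda>_. UNIV)"
      using R(1) unfolding p by (auto simp: cuboid_def)
  qed
  ultimately show ?thesis by (intro exI[of _ ?\<F>] conjI ballI)
qed

text \<open>Weak convergence in finitely many dimensions, reduced to the sets on which it can be
  checked directly. Convergence is required for all cuboids, whatever their boundary; the normal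
  limit charges no such boundary.\<close>

locale cuboid_convergence =
  fixes I :: "'i set" and Q :: "nat \<Rightarrow> ('i \<Rightarrow> real) measure" and R :: "('i \<Rightarrow> real) measure"
  assumes finite_I: "finite I"
    and prob_Q: "prob_space (Q n)" and sets_Q [measurable_cong]: "sets (Q n) = sets (PiM I (\<lambda>_. borel))"
    and prob_R: "prob_space R" and sets_R [measurable_cong]: "sets R = sets (PiM I (\<lambda>_. borel))"
    and cuboid_tendsto: "(\<lambda>n. measure (Q n) (cuboid I a b)) \<longlonglongrightarrow> measure R (cuboid I a b)"
begin

sublocale Q: prob_space "Q n" for n by (rule prob_Q)
sublocale R: prob_space R by (rule prob_R)

text \<open>Inclusion-exclusion, one cuboid at a time. The overlap of \<open>C\<close> with the
  remaining union is again a union of at most as many cuboids as remain. This is a different family,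
  so the induction runs over the cardinality.\<close>

lemma finite_Union_tendsto:
  assumes "finite \<F>" "\<And>C. C \<in> \<F> \<Longrightarrow> \<exists>a b. C = cuboid I a b"
  shows "(\<lambda>n. measure (Q n) (\<Union>\<F>)) \<longlonglongrightarrow> measure R (\<Union>\<F>)"
  using assms
proof (induction "card \<F>" arbitrary: \<F> rule: less_induct)
  case less
  have ms: "\<Union>\<G> \<in> sets (PiM I (\<lambda>_. borel))" if "\<G> \<subseteq> \<F>" for \<G>
  proof (intro sets.finite_Union subsetI)
    show "finite \<G>" using that less.prems(1) finite_subset by blast
    show "C \<in> sets (PiM I (\<lambda>_. borel))" if "C \<in> \<G>" for C
    proof -
      obtain a b where "C = cuboid I a b" using less.prems(2)[of C] \<open>\<G> \<subseteq> \<F>\<close> \<open>C \<in> \<G>\<close> by auto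
      then show ?thesis using finite_I by simp
    qed
  qed
  show ?case
  proof (cases "\<F> = {}")
    case False
    then obtain C where C: "C \<in> \<F>" by auto
    let ?\<G> = "\<F> - {C}" and ?\<H> = "(\<inter>) C ` (\<F> - {C})"
    have card: "card ?\<G> < card \<F>" using C less.prems(1) by (meson card_Diff1_less)
    have un: "\<Union>\<F> = C \<union> \<Union>?\<G>" using C by auto
    have int: "C \<inter> \<Union>?\<G> = \<Union>?\<H>" by auto
    have mC: "C \<in> sets (PiM I (\<lambda>_. borel))" using less.prems(2)[OF C] finite_I by auto
    have eq: "measure (Q n) (\<Union>\<F>) = measure (Q n) C + measure (Q n) (\<Union>?\<G>) - measure (Q n) (\<Union>?\<H>)"
      "measure R (\<Union>\<F>) = measure R C + measure R (\<Union>?\<G>) - measure R (\<Union>?\<H>)" for n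
      unfolding un int[symmetric] using mC ms[of ?\<G>]
      by (auto intro!: measure_Un3 simp: Q.fmeasurable_eq_sets R.fmeasurable_eq_sets sets_Q sets_R)
    have "(\<lambda>n. measure (Q n) C) \<longlonglongrightarrow> measure R C"
      using less.prems(2)[OF C] cuboid_tendsto by auto
    moreover have "(\<lambda>n. measure (Q n) (\<Union>?\<G>)) \<longlonglongrightarrow> measure R (\<Union>?\<G>)"
      using card less.prems by (intro less.hyps) auto
    moreover have "(\<lambda>n. measure (Q n) (\<Union>?\<H>)) \<longlonglongrightarrow> measure R (\<Union>?\<H>)"
    proof (rule less.hyps)
      show "card ?\<H> < card \<F>"
        using card card_image_le[of ?\<G> "(\<inter>) C"] less.prems(1) by auto
      fix D assume "D \<in> ?\<H>"
      then obtain C' where "C' \<in> \<F>" "D = C \<inter> C'" by auto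
      then show "\<exists>a b. D = cuboid I a b"
        using less.prems(2)[OF C] less.prems(2)[of C'] cuboid_Int by metis
    qed (use less.prems in auto)
    ultimately show ?thesis
      unfolding eq by (intro tendsto_intros)
  qed simp
qed

lemma open_measurable:
  fixes U :: "('i \<Rightarrow> real) set"
  assumes "open U" shows "U \<inter> Pi\<^sub>E I (\<lambda>_. UNIV) \<in> sets (PiM I (\<lambda>_. borel))"
proof -
  obtain \<F> where \<F>: "countable \<F>" "\<And>C. C \<in> \<F> \<Longrightarrow> \<exists>a b. C = cuboid I a b"
    "U \<inter> Pi\<^sub>E I (\<lambda>_. UNIV) = \<Union>\<F>"
    using open_eq_countable_Union_cuboid[OF assms finite_I] by metis
  then show ?thesis
    using finite_I by (metis sets.countable_Union sets_cuboid subsetI)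
qed

text \<open>The lower half of the portmanteau theorem: finitely many cuboids inside \<open>U\<close>
  already carry more than \<open>c\<close> of the limit mass, and on their union convergence is
  known.\<close>

lemma open_eventually_gt:
  assumes U: "open U" and c: "c < measure R (U \<inter> Pi\<^sub>E I (\<lambda>_. UNIV))"
  shows "\<forall>\<^sub>F n in sequentially. c < measure (Q n) (U \<inter> Pi\<^sub>E I (\<lambda>_. UNIV))"
proof -
  let ?U = "U \<inter> Pi\<^sub>E I (\<lambda>_. UNIV)"
  obtain \<F> where \<F>: "countable \<F>" "\<And>C. C \<in> \<F> \<Longrightarrow> \<exists>a b. C = cuboid I a b" "?U = \<Union>\<F>"
    using open_eq_countable_Union_cuboid[OF U finite_I] by metis
  show ?thesis
  proof (cases "\<F> = {}")
    case True
    then show ?thesis using c \<F>(3) by simp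
  next
    case False
    \<comment> \<open>The enumeration needs a nonempty family; its finite unions increase to the
      open set.\<close>
    define A where "A k = \<Union>(from_nat_into \<F> ` {..k})" for k
    have range: "range (from_nat_into \<F>) = \<F>" using False \<F>(1) by (rule range_from_nat_into)
    have mA: "A k \<in> sets (PiM I (\<lambda>_. borel))" for k
      unfolding A_def
    proof (intro sets.finite_Union subsetI)
      fix C assume "C \<in> from_nat_into \<F> ` {..k}"
      then have "C \<in> \<F>" using range by auto
      then obtain a b where "C = cuboid I a b" using \<F>(2) by blast
      then show "C \<in> sets (PiM I (\<lambda>_. borel))" using finite_I by simp
    qed simp
    have "(\<Union>k. A k) = \<Union>(range (from_nat_into \<F>))" unfolding A_def by blast
    then have UA: "(\<Union>k. A k) = ?U" unfolding range \<F>(3) .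
    have "(\<lambda>k. measure R (A k)) \<longlonglongrightarrow> measure R (\<Union>k. A k)"
    proof (rule R.finite_Lim_measure_incseq)
      show "range A \<subseteq> sets R" using mA by (auto simp: sets_R)
      show "incseq A" unfolding incseq_def A_def by (intro allI impI Union_mono image_mono) auto
    qed
    then have "\<forall>\<^sub>F k in sequentially. c < measure R (A k)"
      using c unfolding UA by (rule order_tendstoD)
    then obtain k where k: "c < measure R (A k)"
      unfolding eventually_sequentially by blast
    have "(\<lambda>n. measure (Q n) (A k)) \<longlonglongrightarrow> measure R (A k)"
      unfolding A_def
    proof (rule finite_Union_tendsto)
      fix C assume "C \<in> from_nat_into \<F> ` {..k}"
      then have "C \<in> \<F>" using range by auto
      then show "\<exists>a b. C = cuboid I a b" by (rule \<F>(2))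
    qed simp
    then have "\<forall>\<^sub>F n in sequentially. c < measure (Q n) (A k)"
      using k by (rule order_tendstoD)
    then show ?thesis
    proof eventually_elim
      case (elim n)
      also have "measure (Q n) (A k) \<le> measure (Q n) ?U"
        using open_measurable[OF U] UA by (intro Q.finite_measure_mono) (auto simp: sets_Q)
      finally show ?case .
    qed
  qed
qed

text \<open>Lower bounds for open sets suffice on both sides: \<open>{y. f y < 0}\<close> bounds the
  sublevel set from inside, and \<open>{y. 0 < f y}\<close> is its complement. The null level set
  makes the two bounds meet.\<close>

theorem sublevel_tendsto:
  fixes f :: "('i \<Rightarrow> real) \<Rightarrow> real"
  assumes f: "continuous_on UNIV f" and null: "measure R {y \<in> Pi\<^sub>E I (\<lambda>_. UNIV). f y = 0} = 0"
  shows "(\<lambda>n. measure (Q n) {y \<in> Pi\<^sub>E I (\<lambda>_. UNIV). f y \<le> 0}) \<longlonglongrightarrow> measure R {y \<in> Pi\<^sub>E I (\<lambda>_. UNIV). f y \<le> 0}"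
proof -
  let ?L = "{y. f y < 0} \<inter> Pi\<^sub>E I (\<lambda>_. UNIV)" and ?G = "{y. 0 < f y} \<inter> Pi\<^sub>E I (\<lambda>_. UNIV)"
  let ?E = "{y \<in> Pi\<^sub>E I (\<lambda>_. UNIV). f y = 0}" and ?S = "{y \<in> Pi\<^sub>E I (\<lambda>_. UNIV). f y \<le> 0}"
  have oL: "open {y. f y < 0}" and oG: "open {y. 0 < f y}"
    using f by (auto intro!: open_Collect_less continuous_intros)
  have mL: "?L \<in> sets (PiM I (\<lambda>_. borel))" and mG: "?G \<in> sets (PiM I (\<lambda>_. borel))"
    using open_measurable oL oG by auto
  have S: "?S = space (PiM I (\<lambda>_. borel)) - ?G" and E: "?E = (space (PiM I (\<lambda>_. borel)) - ?G) - ?L"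
    by (auto simp: space_PiM)
  have mS: "?S \<in> sets (PiM I (\<lambda>_. borel))" and mE: "?E \<in> sets (PiM I (\<lambda>_. borel))"
    unfolding S E using mL mG by auto
  have SQ: "measure (Q n) ?S = 1 - measure (Q n) ?G" for n
    unfolding S using Q.prob_compl[of ?G n] mG by (simp only: sets_Q sets_eq_imp_space_eq[OF sets_Q])
  have SR: "measure R ?S = 1 - measure R ?G"
    unfolding S using R.prob_compl[of ?G] mG by (simp only: sets_R sets_eq_imp_space_eq[OF sets_R])
  have "?S = ?L \<union> ?E" by auto
  moreover have "measure R (?L \<union> ?E) = measure R ?L + measure R ?E"
    using mL mE by (intro R.finite_measure_Union) (auto simp: sets_R)
  ultimately have "measure R ?S = measure R ?L + measure R ?E" by simp
  then have SL: "measure R ?S = measure R ?L" using null by simp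
  show ?thesis
  proof (rule order_tendstoI)
    fix c assume "c < measure R ?S"
    then have "\<forall>\<^sub>F n in sequentially. c < measure (Q n) ?L"
      using oL by (intro open_eventually_gt) (simp_all only: SL)
    then show "\<forall>\<^sub>F n in sequentially. c < measure (Q n) ?S"
    proof eventually_elim
      case (elim n)
      also have "measure (Q n) ?L \<le> measure (Q n) ?S"
        using mS by (intro Q.finite_measure_mono) (auto simp: sets_Q)
      finally show ?case .
    qed
  next
    fix c assume "measure R ?S < c"
    then have "1 - c < measure R ?G" by (simp add: SR)
    then have "\<forall>\<^sub>F n in sequentially. 1 - c < measure (Q n) ?G"
      using oG by (intro open_eventually_gt)
    then show "\<forall>\<^sub>F n in sequentially. measure (Q n) ?S < c"
      by eventually_elim (simp add: SQ)
  qed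
qed

end

section \<open>The law of the data and the resamples\<close>

text \<open>\<open>\<tau> i\<close> is the position of the observation drawn at step
  \<open>i\<close>. Drawing positions instead of values gives repeated observations their
  multiplicity and makes all maps equally likely.\<close>

definition nmaps :: "nat \<Rightarrow> (nat \<Rightarrow> nat) set" where
  "nmaps n = Pi\<^sub>E {..<n} (\<lambda>_. {..<n})"

definition restr :: "nat \<Rightarrow> (nat \<Rightarrow> 'a) \<Rightarrow> nat \<Rightarrow> 'a" where
  "restr n x = restrict x {..<n}"

lemma restr_apply [simp]: "i < n \<Longrightarrow> restr n x i = x i"
  by (simp add: restr_def)

lemma restr_mem_PiE: "restr n x \<in> Pi\<^sub>E {..<n} A \<longleftrightarrow> (\<forall>i<n. x i \<in> A i)"
  by (auto simp: PiE_iff restr_def)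

lemma finite_nmaps [simp, intro]: "finite (nmaps n)"
  unfolding nmaps_def by (intro finite_PiE) auto

lemma card_nmaps: "card (nmaps n) = n ^ n"
  unfolding nmaps_def by (simp add: card_PiE)

lemma nmaps_less: "\<tau> \<in> nmaps n \<Longrightarrow> i < n \<Longrightarrow> \<tau> i < n"
  unfolding nmaps_def by (auto dest: PiE_mem)

text \<open>The distribution of a statistic \<open>h x y\<close> of the data \<open>x\<close> and one resample \<open>y\<close> under
  resampling from fixed data \<open>x\<close>.\<close>

definition resample_prob ::
  "nat \<Rightarrow> ((nat \<Rightarrow> 'a) \<Rightarrow> (nat \<Rightarrow> 'a) \<Rightarrow> real) \<Rightarrow> (nat \<Rightarrow> 'a) \<Rightarrow> real set \<Rightarrow> real" where
  "resample_prob n h x I = (\<Sum>\<tau>\<in>nmaps n. indicator I (h x (restr n (x \<circ> \<tau>)))) / real (n ^ n)"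

locale bootstrap_sample = prob_space M for M :: "'w measure" +
  fixes D :: "'a measure" and X :: "nat \<Rightarrow> 'w \<Rightarrow> 'a" and n B :: nat
    and Xs :: "nat \<Rightarrow> nat \<Rightarrow> 'w \<Rightarrow> 'a"
  assumes n: "1 \<le> n" and X [measurable]: "\<And>i. X i \<in> measurable M D"
    and resamples: "bootstrap_resamples M D X n B Xs"
begin

abbreviation "Dn \<equiv> PiM {..<n} (\<lambda>_. D)"
abbreviation "data \<omega> \<equiv> restr n (\<lambda>i. X i \<omega>)"
abbreviation "resample b \<omega> \<equiv> restr n (\<lambda>i. Xs b i \<omega>)"

lemma X_space: "\<omega> \<in> space M \<Longrightarrow> X i \<omega> \<in> space D"
  using X by (rule measurable_space)

lemma Xs [measurable]: "b < B \<Longrightarrow> i < n \<Longrightarrow> Xs b i \<in> measurable M D"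
  using resamples by (simp add: bootstrap_resamples_def)

lemma data_measurable [measurable]: "(\<lambda>\<omega>. data \<omega>) \<in> measurable M Dn"
  unfolding restr_def by measurable

lemma resample_measurable: "b < B \<Longrightarrow> (\<lambda>\<omega>. resample b \<omega>) \<in> measurable M Dn"
  unfolding restr_def by (rule measurable_restrict) auto

lemma sets_data_sigma: "sets (data_sigma M D X n) = {(\<lambda>\<omega>. data \<omega>) -` E \<inter> space M | E. E \<in> sets Dn}"
  unfolding data_sigma_def using measurable_space[OF data_measurable]
  by (subst sets_vimage_algebra2) (auto simp: restr_def)

lemma subalgebra_data_sigma: "subalgebra M (data_sigma M D X n)"
  unfolding subalgebra_def
proof
  show "space (data_sigma M D X n) = space M" by (simp add: data_sigma_def)
  show "sets (data_sigma M D X n) \<subseteq> sets M"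
    unfolding sets_data_sigma using measurable_sets[OF data_measurable] by auto
qed

text \<open>The defining property of conditional expectation, integrated over an event of the data.
  It turns the almost sure identity in \<open>bootstrap_resamples\<close> into one about plain
  probabilities.\<close>

lemma measure_resample_rectangle:
  assumes E: "E \<in> sets (data_sigma M D X n)" and A: "\<And>b i. b < B \<Longrightarrow> i < n \<Longrightarrow> A b i \<in> sets D"
  shows "measure M (E \<inter> {\<omega> \<in> space M. \<forall>b<B. \<forall>i<n. Xs b i \<omega> \<in> A b i})
       = (\<integral>\<omega>. indicator E \<omega> * (\<Prod>b<B. \<Prod>i<n. measure (empirical D n (\<lambda>j. X j \<omega>)) (A b i)) \<partial>M)"
proof -
  interpret fms: finite_measure_subalgebra M "data_sigma M D X n"
    by unfold_locales (rule subalgebra_data_sigma)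
  define R where "R = {\<omega> \<in> space M. \<forall>b<B. \<forall>i<n. Xs b i \<omega> \<in> A b i}"
  have EM [measurable]: "E \<in> sets M" using E subalgebra_data_sigma by (auto simp: subalgebra_def)
  have R [measurable]: "R \<in> sets M"
  proof -
    have "R = {\<omega> \<in> space M. \<forall>b\<in>{..<B}. \<forall>i\<in>{..<n}. Xs b i \<omega> \<in> A b i}" by (auto simp: R_def)
    also have "\<dots> \<in> sets M"
    proof (intro sets.sets_Collect_finite_All)
      fix b i assume "b \<in> {..<B}" "i \<in> {..<n}"
      then have "b < B" "i < n" by auto
      from measurable_sets[OF Xs[OF this] A[OF this]]
      show "{\<omega> \<in> space M. Xs b i \<omega> \<in> A b i} \<in> sets M"
        by (simp add: vimage_def Int_def conj_commute)
    qed auto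
    finally show ?thesis .
  qed
  have "measure M (E \<inter> R) = (\<integral>\<omega>. indicator (E \<inter> R) \<omega> \<partial>M)"
    by (simp only: Bochner_Integration.integral_indicator Int_absorb2[OF sets.sets_into_space[OF sets.Int[OF EM R]]])
  also have "\<dots> = (\<integral>\<omega>\<in>E. indicator R \<omega> \<partial>M)"
    unfolding set_lebesgue_integral_def real_scaleR_def indicator_inter_arith ..
  also have "\<dots> = (\<integral>\<omega>\<in>E. real_cond_exp M (data_sigma M D X n) (indicator R) \<omega> \<partial>M)"
    using E R by (intro fms.real_cond_exp_intA integrable_real_indicator) (simp_all add: emeasure_eq_measure)
  also have "\<dots> = (\<integral>\<omega>. indicator E \<omega> * (\<Prod>b<B. \<Prod>i<n. measure (empirical D n (\<lambda>j. X j \<omega>)) (A b i)) \<partial>M)"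
    unfolding set_lebesgue_integral_def
  proof (rule integral_cong_AE)
    have "AE \<omega> in M. real_cond_exp M (data_sigma M D X n) (indicator R) \<omega>
           = (\<Prod>b<B. \<Prod>i<n. measure (empirical D n (\<lambda>j. X j \<omega>)) (A b i))"
      using resamples A by (simp add: bootstrap_resamples_def R_def)
    then show "AE \<omega> in M. indicator E \<omega> *\<^sub>R real_cond_exp M (data_sigma M D X n) (indicator R) \<omega>
           = indicator E \<omega> * (\<Prod>b<B. \<Prod>i<n. measure (empirical D n (\<lambda>j. X j \<omega>)) (A b i))"
      by eventually_elim simp
    have "(\<lambda>\<omega>. \<Prod>b<B. \<Prod>i<n. 1 / real n * (\<Sum>j<n. indicator (A b i) (X j \<omega>))) \<in> borel_measurable M"
      using A by (intro borel_measurable_prod borel_measurable_times borel_measurable_const borel_measurable_sum)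
        (auto intro!: measurable_compose[OF X])
    then have "(\<lambda>\<omega>. \<Prod>b<B. \<Prod>i<n. measure (empirical D n (\<lambda>j. X j \<omega>)) (A b i)) \<in> borel_measurable M"
      by (rule measurable_cong[THEN iffD1, rotated])
        (auto intro!: prod.cong simp: A measure_empirical X_space)
    then show "(\<lambda>\<omega>. indicator E \<omega> * (\<Prod>b<B. \<Prod>i<n. measure (empirical D n (\<lambda>j. X j \<omega>)) (A b i)))
        \<in> borel_measurable M"
      by (intro borel_measurable_times) auto
  qed auto
  finally show ?thesis unfolding R_def .
qed

text \<open>Row \<open>0\<close> of the joint array holds the data, row \<open>Suc b\<close> the resample \<open>b\<close>.\<close>

definition joint_index :: "(nat \<times> nat) set" where
  "joint_index = {..B} \<times> {..<n}"

abbreviation "DJ \<equiv> PiM joint_index (\<lambda>_. D)"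

definition joint :: "'w \<Rightarrow> nat \<times> nat \<Rightarrow> 'a" where
  "joint \<omega> = (\<lambda>j\<in>joint_index. case j of (0, i) \<Rightarrow> X i \<omega> | (Suc b, i) \<Rightarrow> Xs b i \<omega>)"

text \<open>The counterpart of \<open>joint\<close> for index maps fixed in advance. Only the data
  remain random, so averaging over the maps gives an explicit candidate for the law of
  \<open>joint\<close>.\<close>

definition joint_at :: "(nat \<Rightarrow> nat \<Rightarrow> nat) \<Rightarrow> 'w \<Rightarrow> nat \<times> nat \<Rightarrow> 'a" where
  "joint_at \<tau> \<omega> = (\<lambda>j\<in>joint_index. case j of (0, i) \<Rightarrow> X i \<omega> | (Suc b, i) \<Rightarrow> X (\<tau> b i) \<omega>)"

lemma finite_joint_index [simp, intro]: "finite joint_index"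
  by (simp add: joint_index_def)

lemma joint_measurable [measurable]: "joint \<in> measurable M DJ"
  unfolding joint_def
  by (rule measurable_restrict) (auto simp: joint_index_def Suc_le_eq split: nat.split)

lemma joint_at_measurable [measurable]: "joint_at \<tau> \<in> measurable M DJ"
  unfolding joint_at_def
  by (rule measurable_restrict) (auto simp: joint_index_def split: nat.split)

definition choices :: "(nat \<Rightarrow> nat \<Rightarrow> nat) set" where
  "choices = Pi\<^sub>E {..<B} (\<lambda>_. nmaps n)"

lemma finite_choices [simp, intro]: "finite choices"
  unfolding choices_def by (intro finite_PiE) auto

lemma card_choices: "card choices = (n ^ n) ^ B"
  unfolding choices_def by (simp add: card_PiE card_nmaps)

text \<open>Distributivity, first over the points of one resample and then over the resamples: a
  product of averages is the average over all ways to pick one term from each factor.\<close>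

lemma prod_emp_eq_sum_choices:
  assumes x: "\<And>i. i < n \<Longrightarrow> x i \<in> space D" and A: "\<And>b i. b < B \<Longrightarrow> i < n \<Longrightarrow> A b i \<in> sets D"
  shows "(\<Prod>b<B. \<Prod>i<n. measure (empirical D n x) (A b i))
       = (\<Sum>\<tau>\<in>choices. \<Prod>b<B. \<Prod>i<n. indicator (A b i) (x (\<tau> b i))) / real (card choices)"
proof -
  have "(\<Prod>b<B. \<Prod>i<n. measure (empirical D n x) (A b i))
      = (\<Prod>b<B. \<Prod>i<n. 1 / real n * (\<Sum>j<n. indicator (A b i) (x j)))"
    using x A by (intro prod.cong refl) (simp add: measure_empirical)
  also have "\<dots> = (\<Prod>b<B. 1 / real (n ^ n) * (\<Prod>i<n. \<Sum>j<n. indicator (A b i) (x j)))"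
    unfolding prod.distrib by (simp add: power_divide)
  also have "\<dots> = (\<Prod>b<B. \<Sum>\<tau>\<in>nmaps n. \<Prod>i<n. indicator (A b i) (x (\<tau> i))) / real (card choices)"
    unfolding prod.distrib by (subst prod_sum_PiE) (auto simp: nmaps_def power_divide card_choices)
  also have "(\<Prod>b<B. \<Sum>\<tau>\<in>nmaps n. \<Prod>i<n. indicator (A b i) (x (\<tau> i)))
      = (\<Sum>\<tau>\<in>choices. \<Prod>b<B. \<Prod>i<n. indicator (A b i) (x (\<tau> b i)) :: real)"
    unfolding choices_def by (subst prod_sum_PiE) auto
  finally show ?thesis .
qed

text \<open>The given resamples need not come from random index maps on \<open>M\<close>. Here they
  are modelled as if they did, with maps drawn uniformly and independently of the data; only the law
  matters.\<close>

definition mixture :: "(nat \<times> nat \<Rightarrow> 'a) measure" where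
  "mixture = distr (uniform_count_measure choices \<Otimes>\<^sub>M M) DJ (\<lambda>(\<tau>, \<omega>). joint_at \<tau> \<omega>)"

lemma emeasure_mixture:
  assumes C: "C \<in> sets DJ"
  shows "emeasure mixture C = (\<Sum>\<tau>\<in>choices. measure M {\<omega> \<in> space M. joint_at \<tau> \<omega> \<in> C}) / real (card choices)"
proof -
  have meas: "(\<lambda>(\<tau>, \<omega>). joint_at \<tau> \<omega>) \<in> measurable (uniform_count_measure choices \<Otimes>\<^sub>M M) DJ"
  proof (subst measurable_cong_sets[OF sets_pair_measure_cong[OF sets_uniform_count_measure_count_space refl] refl],
      rule measurable_pair_measure_countable1)
    show "countable choices" by (intro countable_finite) auto
  qed simp
  have "emeasure mixture C = emeasure (uniform_count_measure choices \<Otimes>\<^sub>M M)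
      ((\<lambda>(\<tau>, \<omega>). joint_at \<tau> \<omega>) -` C \<inter> space (uniform_count_measure choices \<Otimes>\<^sub>M M))" (is "_ = emeasure _ ?V")
    unfolding mixture_def using meas C by (rule emeasure_distr)
  also have "\<dots> = (\<integral>\<^sup>+\<tau>. emeasure M (Pair \<tau> -` ?V) \<partial>uniform_count_measure choices)"
    by (rule emeasure_pair_measure_alt) (rule measurable_sets[OF meas C])
  also have "\<dots> = (\<Sum>\<tau>\<in>choices. ennreal (1 / real (card choices)) * emeasure M (Pair \<tau> -` ?V))"
    unfolding uniform_count_measure_def by (rule nn_integral_point_measure_finite) simp
  also have "\<dots> = (\<Sum>\<tau>\<in>choices. ennreal (measure M {\<omega> \<in> space M. joint_at \<tau> \<omega> \<in> C} / real (card choices)))"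
  proof (rule sum.cong[OF refl])
    fix \<tau> assume "\<tau> \<in> choices"
    then have "Pair \<tau> -` ?V = {\<omega> \<in> space M. joint_at \<tau> \<omega> \<in> C}"
      by (simp add: space_pair_measure space_uniform_count_measure vimage_def Int_def conj_commute)
    then show "ennreal (1 / real (card choices)) * emeasure M (Pair \<tau> -` ?V)
        = ennreal (measure M {\<omega> \<in> space M. joint_at \<tau> \<omega> \<in> C} / real (card choices))"
      by (simp add: emeasure_eq_measure flip: ennreal_mult')
  qed
  finally show ?thesis
    by (simp add: sum_ennreal sum_divide_distrib)
qed

lemma joint_mem_PiE: "joint \<omega> \<in> Pi\<^sub>E joint_index A \<longleftrightarrow>
    (\<forall>i<n. X i \<omega> \<in> A (0, i)) \<and> (\<forall>b<B. \<forall>i<n. Xs b i \<omega> \<in> A (Suc b, i))"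
proof -
  have "joint \<omega> \<in> Pi\<^sub>E joint_index A \<longleftrightarrow> (\<forall>a\<le>B. \<forall>i<n. joint \<omega> (a, i) \<in> A (a, i))"
    by (auto simp: PiE_iff joint_def joint_index_def)
  also have "\<dots> \<longleftrightarrow> (\<forall>i<n. joint \<omega> (0, i) \<in> A (0, i)) \<and> (\<forall>b<B. \<forall>i<n. joint \<omega> (Suc b, i) \<in> A (Suc b, i))"
    by (metis Suc_le_eq not0_implies_Suc zero_le)
  finally show ?thesis
    by (simp add: joint_def joint_index_def Suc_le_eq)
qed

lemma joint_at_mem_PiE: "joint_at \<tau> \<omega> \<in> Pi\<^sub>E joint_index A \<longleftrightarrow>
    (\<forall>i<n. X i \<omega> \<in> A (0, i)) \<and> (\<forall>b<B. \<forall>i<n. X (\<tau> b i) \<omega> \<in> A (Suc b, i))"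
proof -
  have "joint_at \<tau> \<omega> \<in> Pi\<^sub>E joint_index A \<longleftrightarrow> (\<forall>a\<le>B. \<forall>i<n. joint_at \<tau> \<omega> (a, i) \<in> A (a, i))"
    by (auto simp: PiE_iff joint_at_def joint_index_def)
  also have "\<dots> \<longleftrightarrow> (\<forall>i<n. joint_at \<tau> \<omega> (0, i) \<in> A (0, i)) \<and> (\<forall>b<B. \<forall>i<n. joint_at \<tau> \<omega> (Suc b, i) \<in> A (Suc b, i))"
    by (metis Suc_le_eq not0_implies_Suc zero_le)
  finally show ?thesis
    by (simp add: joint_at_def joint_index_def Suc_le_eq)
qed

text \<open>Rectangles determine the law. In a rectangle the sides of row \<open>0\<close> restrict
  the data, and the other rows give the product of empirical masses, which expands into an average
  over \<open>choices\<close>.\<close>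

lemma distr_joint: "distr M DJ joint = mixture"
proof (rule measure_eqI_PiM_finite[where M = "\<lambda>_. D" and A = "\<lambda>_. space DJ"])
  show "sets (distr M DJ joint) = sets DJ" "sets mixture = sets DJ"
    by (simp_all add: mixture_def)
  show "range (\<lambda>_. space DJ) \<subseteq> prod_algebra joint_index (\<lambda>_. D)"
    by (auto simp: space_PiM intro!: prod_algebraI_finite)
  have "prob_space (distr M DJ joint)" by (intro prob_space_distr) measurable
  then show "emeasure (distr M DJ joint) (space DJ) \<noteq> \<infinity>"
    by (auto intro!: finite_measure.emeasure_finite simp: prob_space_def)
next
  fix A assume A: "\<And>j. j \<in> joint_index \<Longrightarrow> A j \<in> sets D"
  then have A': "A (Suc b, i) \<in> sets D" if "b < B" "i < n" for b i
    using that by (auto simp: joint_index_def)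
  have A0: "A (0, i) \<in> sets D" if "i < n" for i
    using that A by (auto simp: joint_index_def)
  have C: "Pi\<^sub>E joint_index A \<in> sets DJ" using A by (intro sets_PiM_I_finite) auto
  \<comment> \<open>Row \<open>0\<close> concerns the data alone, so its sides cut out an event of
    the conditioning sigma-algebra.\<close>
  define E where "E = {\<omega> \<in> space M. \<forall>i<n. X i \<omega> \<in> A (0, i)}"
  have E: "E \<in> sets (data_sigma M D X n)"
  proof -
    have "E = (\<lambda>\<omega>. data \<omega>) -` Pi\<^sub>E {..<n} (\<lambda>i. A (0, i)) \<inter> space M"
      by (simp add: E_def restr_mem_PiE vimage_def Int_def conj_commute)
    moreover have "Pi\<^sub>E {..<n} (\<lambda>i. A (0, i)) \<in> sets Dn"
      using A0 by (intro sets_PiM_I_finite) auto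
    ultimately show ?thesis unfolding sets_data_sigma by (intro CollectI exI conjI)
  qed
  let ?g = "\<lambda>\<tau> \<omega>. indicator E \<omega> * (\<Prod>b<B. \<Prod>i<n. indicator (A (Suc b, i)) (X (\<tau> b i) \<omega>) :: real)"
  have g: "?g \<tau> \<omega> = indicator {\<omega> \<in> space M. joint_at \<tau> \<omega> \<in> Pi\<^sub>E joint_index A} \<omega>" if "\<omega> \<in> space M" for \<tau> \<omega>
  proof -
    have "(\<Prod>b<B. \<Prod>i<n. indicator (A (Suc b, i)) (X (\<tau> b i) \<omega>) :: real)
        = (if \<forall>b<B. \<forall>i<n. X (\<tau> b i) \<omega> \<in> A (Suc b, i) then 1 else 0)"
      by (auto simp: indicator_def)
    then show ?thesis
      using that unfolding joint_at_mem_PiE by (simp add: indicator_def E_def)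
  qed
  have Cat: "{\<omega> \<in> space M. joint_at \<tau> \<omega> \<in> Pi\<^sub>E joint_index A} \<in> sets M" for \<tau>
    using measurable_sets[OF joint_at_measurable C] by (simp add: vimage_def Int_def conj_commute)
  have "emeasure (distr M DJ joint) (Pi\<^sub>E joint_index A)
      = measure M (joint -` Pi\<^sub>E joint_index A \<inter> space M)"
    by (subst emeasure_distr[OF joint_measurable C]) (rule emeasure_eq_measure)
  also have "joint -` Pi\<^sub>E joint_index A \<inter> space M
      = E \<inter> {\<omega> \<in> space M. \<forall>b<B. \<forall>i<n. Xs b i \<omega> \<in> A (Suc b, i)}"
    by (auto simp: joint_mem_PiE E_def)
  also have "measure M \<dots> = (\<integral>\<omega>. indicator E \<omega> * (\<Prod>b<B. \<Prod>i<n. measure (empirical D n (\<lambda>j. X j \<omega>)) (A (Suc b, i))) \<partial>M)"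
    using E A' by (rule measure_resample_rectangle)
  also have "\<dots> = (\<integral>\<omega>. (\<Sum>\<tau>\<in>choices. indicator {\<omega> \<in> space M. joint_at \<tau> \<omega> \<in> Pi\<^sub>E joint_index A} \<omega>) / real (card choices) \<partial>M)"
  proof (rule Bochner_Integration.integral_cong[OF refl])
    fix \<omega> assume \<omega>: "\<omega> \<in> space M"
    have "indicator E \<omega> * (\<Prod>b<B. \<Prod>i<n. measure (empirical D n (\<lambda>j. X j \<omega>)) (A (Suc b, i)))
        = (\<Sum>\<tau>\<in>choices. ?g \<tau> \<omega>) / real (card choices)"
      using A' X_space[OF \<omega>] by (subst prod_emp_eq_sum_choices) (auto simp: sum_distrib_left)
    also have "(\<Sum>\<tau>\<in>choices. ?g \<tau> \<omega>) = (\<Sum>\<tau>\<in>choices. indicator {\<omega> \<in> space M. joint_at \<tau> \<omega> \<in> Pi\<^sub>E joint_index A} \<omega>)"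
      by (intro sum.cong refl g \<omega>)
    finally show "indicator E \<omega> * (\<Prod>b<B. \<Prod>i<n. measure (empirical D n (\<lambda>j. X j \<omega>)) (A (Suc b, i)))
        = (\<Sum>\<tau>\<in>choices. indicator {\<omega> \<in> space M. joint_at \<tau> \<omega> \<in> Pi\<^sub>E joint_index A} \<omega>) / real (card choices)" .
  qed
  also have "\<dots> = (\<Sum>\<tau>\<in>choices. measure M {\<omega> \<in> space M. joint_at \<tau> \<omega> \<in> Pi\<^sub>E joint_index A}) / real (card choices)"
    using Cat by (simp add: Bochner_Integration.integral_sum emeasure_eq_measure)
  finally show "emeasure (distr M DJ joint) (Pi\<^sub>E joint_index A) = emeasure mixture (Pi\<^sub>E joint_index A)"
    unfolding emeasure_mixture[OF C] .
qed auto

text \<open>Events about statistics are not rectangles; equality of the laws covers them as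
  well.\<close>

lemma measure_joint:
  assumes C: "C \<in> sets DJ"
  shows "measure M {\<omega> \<in> space M. joint \<omega> \<in> C}
    = (\<Sum>\<tau>\<in>choices. measure M {\<omega> \<in> space M. joint_at \<tau> \<omega> \<in> C}) / real (card choices)"
proof -
  have "ennreal (measure M {\<omega> \<in> space M. joint \<omega> \<in> C}) = emeasure (distr M DJ joint) C"
    by (subst emeasure_distr[OF joint_measurable C])
      (simp add: emeasure_eq_measure vimage_def Int_def conj_commute)
  then show ?thesis
    unfolding distr_joint emeasure_mixture[OF C]
    by (subst (asm) ennreal_inj) (auto intro!: divide_nonneg_nonneg sum_nonneg)
qed

end

section \<open>Permutation invariance of the empirical distribution and of resampling\<close>

lemma empirical_cong: "(\<And>i. i < n \<Longrightarrow> x i = y i) \<Longrightarrow> empirical D n x = empirical D n y"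
  unfolding empirical_def by (rule distr_cong) (auto simp: space_uniform_count_measure)

lemma empirical_restr [simp]: "empirical D n (restr n x) = empirical D n x"
  by (rule empirical_cong) simp

lemma prob_space_empirical:
  assumes n: "1 \<le> n" and x: "\<And>i. i < n \<Longrightarrow> x i \<in> space D"
  shows "prob_space (empirical D n x)"
  unfolding empirical_def
proof (rule prob_space.prob_space_distr)
  show "prob_space (uniform_count_measure {..<n})"
    using n by (intro prob_space_uniform_count_measure) (auto simp: lessThan_empty_iff)
  show "x \<in> measurable (uniform_count_measure {..<n}) D"
    using x by (auto simp: measurable_def space_uniform_count_measure sets_uniform_count_measure)
qed

lemma empirical_measurable:
  assumes n: "1 \<le> n"
  shows "empirical D n \<in> measurable (PiM {..<n} (\<lambda>_. D)) (prob_algebra D)"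
proof (rule measurable_prob_algebraI)
  have x: "x i \<in> space D" if "x \<in> space (PiM {..<n} (\<lambda>_. D))" "i < n" for x i
    using that unfolding space_PiM by (auto dest: PiE_mem)
  show ps: "prob_space (empirical D n x)" if "x \<in> space (PiM {..<n} (\<lambda>_. D))" for x
    using n x[OF that] by (rule prob_space_empirical)
  show "empirical D n \<in> measurable (PiM {..<n} (\<lambda>_. D)) (subprob_algebra D)"
  proof (rule measurable_subprob_algebra)
    fix A assume A: "A \<in> sets D"
    have "(\<lambda>x. ennreal (1 / real n * (\<Sum>i<n. indicator A (x i)))) \<in> borel_measurable (PiM {..<n} (\<lambda>_. D))"
      using A by (intro measurable_compose[OF _ measurable_ennreal] borel_measurable_times
        borel_measurable_const borel_measurable_sum measurable_compose[OF measurable_component_singleton[of _ _ "\<lambda>_. D"] borel_measurable_indicator]) auto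
    then show "(\<lambda>x. emeasure (empirical D n x) A) \<in> borel_measurable (PiM {..<n} (\<lambda>_. D))"
    proof (rule measurable_cong[THEN iffD1, rotated])
      fix x assume xs: "x \<in> space (PiM {..<n} (\<lambda>_. D))"
      interpret E: prob_space "empirical D n x" by (rule ps[OF xs])
      show "ennreal (1 / real n * (\<Sum>i<n. indicator A (x i))) = emeasure (empirical D n x) A"
        unfolding E.emeasure_eq_measure using x[OF xs] A by (subst measure_empirical) auto
    qed
  qed (auto intro: ps prob_space_imp_subprob_space)
qed

lemma empirical_permute:
  assumes n: "1 \<le> n" and x: "\<And>i. i < n \<Longrightarrow> x i \<in> space D" and \<sigma>: "\<sigma> permutes {..<n}"
  shows "empirical D n (x \<circ> \<sigma>) = empirical D n x"
proof (rule measure_eqI)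
  have x': "(x \<circ> \<sigma>) i \<in> space D" if "i < n" for i
    using x permutes_in_image[OF \<sigma>, of i] that by simp
  interpret E: prob_space "empirical D n x" using n x by (rule prob_space_empirical)
  interpret E': prob_space "empirical D n (x \<circ> \<sigma>)" using n x' by (rule prob_space_empirical)
  fix A assume "A \<in> sets (empirical D n (x \<circ> \<sigma>))"
  then have A: "A \<in> sets D" by simp
  have "(\<Sum>i<n. indicator A (x (\<sigma> i)) :: real) = (\<Sum>i<n. indicator A (x i))"
    using sum.permute[OF \<sigma>, of "\<lambda>i. indicator A (x i) :: real"] by (simp add: o_def)
  then show "emeasure (empirical D n (x \<circ> \<sigma>)) A = emeasure (empirical D n x) A"
    using measure_empirical[of n "x \<circ> \<sigma>" D A, OF x' A] measure_empirical[of n x D A, OF x A]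
    by (simp add: E.emeasure_eq_measure E'.emeasure_eq_measure)
qed simp

lemma restr_permute_permute: "restr n (restr n x \<circ> \<sigma>) = restr n (x \<circ> \<sigma>)" if "\<sigma> permutes {..<n}"
  using permutes_in_image[OF that] by (auto simp: restr_def fun_eq_iff)

lemma bij_betw_nmaps_permute:
  assumes \<sigma>: "\<sigma> permutes {..<n}"
  shows "bij_betw (\<lambda>\<tau>. restr n (\<sigma> \<circ> \<tau>)) (nmaps n) (nmaps n)"
proof -
  have mem: "restr n (p \<circ> \<tau>) \<in> nmaps n" if "p permutes {..<n}" "\<tau> \<in> nmaps n" for p \<tau>
    using permutes_in_image[OF that(1)] nmaps_less[OF that(2)]
    by (simp add: nmaps_def PiE_iff restr_def)
  have ext: "restr n \<tau> = \<tau>" if "\<tau> \<in> nmaps n" for \<tau>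
    using that unfolding nmaps_def restr_def by (rule PiE_restrict)
  have inv: "restr n (q \<circ> restr n (p \<circ> \<tau>)) = \<tau>" if "\<tau> \<in> nmaps n" "\<And>i. q (p i) = i" for p q \<tau>
  proof -
    have "restr n (q \<circ> restr n (p \<circ> \<tau>)) = restr n \<tau>"
      using that(2) by (auto simp: restr_def fun_eq_iff)
    then show ?thesis using ext[OF that(1)] by simp
  qed
  show ?thesis
    by (rule bij_betw_byWitness[where f' = "\<lambda>\<tau>. restr n (inv \<sigma> \<circ> \<tau>)"])
      (auto intro!: mem inv permutes_inv \<sigma> simp: permutes_inverses[OF \<sigma>])
qed

lemma resample_prob_UNIV: "1 \<le> n \<Longrightarrow> resample_prob n h x UNIV = 1"
  by (simp add: resample_prob_def card_nmaps)

lemma resample_prob_nonneg: "0 \<le> resample_prob n h x I"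
  by (simp add: resample_prob_def sum_nonneg)

lemma resample_prob_le_1: "resample_prob n h x I \<le> 1"
proof -
  have "(\<Sum>\<tau>\<in>nmaps n. indicator I (h x (restr n (x \<circ> \<tau>)))) \<le> (\<Sum>\<tau>\<in>nmaps n. 1 :: real)"
    by (intro sum_mono) (simp add: indicator_def)
  then show ?thesis by (cases "n = 0") (simp_all add: resample_prob_def card_nmaps divide_le_eq)
qed

lemma resample_prob_Ioc:
  assumes "a \<le> b"
  shows "resample_prob n h x {a<..b} = resample_prob n h x {..b} - resample_prob n h x {..a}"
proof -
  have "indicator {a<..b} y = (indicator {..b} y - indicator {..a} y :: real)" for y
    using assms by (auto simp: indicator_def)
  then show ?thesis by (simp add: resample_prob_def sum_subtractf diff_divide_distrib)
qed

text \<open>Permuting the data only relabels the index maps, and the average runs over all of them.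
  The direct dependence of \<open>h\<close> on the data has to be symmetric by itself.\<close>

lemma resample_prob_permute:
  assumes \<sigma>: "\<sigma> permutes {..<n}" and h: "\<And>y. h (restr n (x \<circ> \<sigma>)) y = h x y"
  shows "resample_prob n h (restr n (x \<circ> \<sigma>)) I = resample_prob n h x I"
proof -
  have "(\<Sum>\<tau>\<in>nmaps n. indicator I (h (restr n (x \<circ> \<sigma>)) (restr n (restr n (x \<circ> \<sigma>) \<circ> \<tau>))))
      = (\<Sum>\<tau>\<in>nmaps n. indicator I (h x (restr n (x \<circ> restr n (\<sigma> \<circ> \<tau>)))) :: real)"
  proof (rule sum.cong[OF refl])
    fix \<tau> assume "\<tau> \<in> nmaps n"
    then have "restr n (restr n (x \<circ> \<sigma>) \<circ> \<tau>) = restr n (x \<circ> restr n (\<sigma> \<circ> \<tau>))"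
      by (auto simp: restr_def fun_eq_iff dest: nmaps_less)
    then show "indicator I (h (restr n (x \<circ> \<sigma>)) (restr n (restr n (x \<circ> \<sigma>) \<circ> \<tau>)))
        = (indicator I (h x (restr n (x \<circ> restr n (\<sigma> \<circ> \<tau>)))) :: real)"
      by (simp add: h)
  qed
  also have "\<dots> = (\<Sum>\<tau>\<in>nmaps n. indicator I (h x (restr n (x \<circ> \<tau>))))"
    by (rule sum.reindex_bij_betw[OF bij_betw_nmaps_permute[OF \<sigma>]])
  finally show ?thesis by (simp add: resample_prob_def)
qed

context bootstrap_sample
begin

lemma data_space: "\<omega> \<in> space M \<Longrightarrow> data \<omega> \<in> space Dn"
  using data_measurable by (rule measurable_space)

lemma resample_prob_measurable:
  assumes h: "(\<lambda>(x, y). h x y) \<in> borel_measurable (Dn \<Otimes>\<^sub>M Dn)" and I: "I \<in> sets borel"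
  shows "(\<lambda>x. resample_prob n h x I) \<in> borel_measurable Dn"
proof -
  have "(\<lambda>x. indicator I (h x (restr n (x \<circ> \<tau>))) :: real) \<in> borel_measurable Dn" if \<tau>: "\<tau> \<in> nmaps n" for \<tau>
  proof -
    have "(\<lambda>x. restr n (x \<circ> \<tau>)) \<in> measurable Dn Dn"
      unfolding restr_def o_def using nmaps_less[OF \<tau>] by (intro measurable_restrict measurable_component_singleton) auto
    then have "(\<lambda>x. (x, restr n (x \<circ> \<tau>))) \<in> measurable Dn (Dn \<Otimes>\<^sub>M Dn)"
      by (intro measurable_Pair measurable_ident_sets refl)
    from measurable_compose[OF this h]
    have "(\<lambda>x. h x (restr n (x \<circ> \<tau>))) \<in> borel_measurable Dn" by simp
    from measurable_compose[OF this borel_measurable_indicator[OF I]]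
    show ?thesis .
  qed
  then show ?thesis unfolding resample_prob_def by (intro borel_measurable_divide borel_measurable_sum) auto
qed

text \<open>Conditional independence of the statistics given the data, with common law
  \<open>resample_prob\<close>, stated in integrated form so that no conditional kernel is
  involved.\<close>

theorem measure_resample_statistics:
  assumes h: "(\<lambda>(x, y). h x y) \<in> borel_measurable (Dn \<Otimes>\<^sub>M Dn)"
    and E: "E \<in> sets Dn" and I: "\<And>b. b < B \<Longrightarrow> I b \<in> sets borel"
  shows "measure M {\<omega> \<in> space M. data \<omega> \<in> E \<and> (\<forall>b<B. h (data \<omega>) (resample b \<omega>) \<in> I b)}
       = (\<integral>\<omega>. indicator E (data \<omega>) * (\<Prod>b<B. resample_prob n h (data \<omega>) (I b)) \<partial>M)"
proof -
  let ?p = "\<lambda>a w. restr n (\<lambda>i. w (a, i))"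
  \<comment> \<open>The event as a set of arrays: \<open>h\<close> compares row \<open>0\<close>
    with row \<open>Suc b\<close>.\<close>
  define C where "C = {w \<in> space DJ. ?p 0 w \<in> E \<and> (\<forall>b\<in>{..<B}. h (?p 0 w) (?p (Suc b) w) \<in> I b)}"
  have p: "?p a \<in> measurable DJ Dn" if "a \<le> B" for a
    unfolding restr_def using that
    by (intro measurable_restrict measurable_component_singleton) (auto simp: joint_index_def)
  have C: "C \<in> sets DJ"
    unfolding C_def
  proof (intro sets.sets_Collect_conj sets.sets_Collect_finite_All)
    show "{w \<in> space DJ. ?p 0 w \<in> E} \<in> sets DJ"
      using measurable_sets[OF p E] by (simp add: vimage_def Int_def conj_commute)
    fix b assume b: "b \<in> {..<B}"
    then have "(\<lambda>w. (?p 0 w, ?p (Suc b) w)) \<in> measurable DJ (Dn \<Otimes>\<^sub>M Dn)"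
      by (intro measurable_Pair p) auto
    from measurable_sets[OF measurable_compose[OF this h] I, of b] b
    show "{w \<in> space DJ. h (?p 0 w) (?p (Suc b) w) \<in> I b} \<in> sets DJ"
      by (simp add: vimage_def Int_def conj_commute)
  qed simp
  have p_joint: "?p 0 (joint \<omega>) = data \<omega>" "b < B \<Longrightarrow> ?p (Suc b) (joint \<omega>) = resample b \<omega>" for b \<omega>
    by (auto simp: joint_def joint_index_def restr_def fun_eq_iff)
  have p_joint_at: "?p 0 (joint_at \<tau> \<omega>) = data \<omega>"
    "\<lbrakk>\<tau> \<in> choices; b < B\<rbrakk> \<Longrightarrow> ?p (Suc b) (joint_at \<tau> \<omega>) = restr n (data \<omega> \<circ> \<tau> b)" for b \<tau> \<omega>
  proof -
    show "?p 0 (joint_at \<tau> \<omega>) = data \<omega>"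
      by (auto simp: joint_at_def joint_index_def restr_def fun_eq_iff)
    assume "\<tau> \<in> choices" "b < B"
    then have "\<tau> b \<in> nmaps n" unfolding choices_def by (auto dest: PiE_mem)
    with \<open>b < B\<close> show "?p (Suc b) (joint_at \<tau> \<omega>) = restr n (data \<omega> \<circ> \<tau> b)"
      by (auto simp: joint_at_def joint_index_def restr_def fun_eq_iff dest: nmaps_less)
  qed
  have "{\<omega> \<in> space M. data \<omega> \<in> E \<and> (\<forall>b<B. h (data \<omega>) (resample b \<omega>) \<in> I b)} = {\<omega> \<in> space M. joint \<omega> \<in> C}"
    using measurable_space[OF joint_measurable] by (auto simp: C_def p_joint)
  then have "measure M {\<omega> \<in> space M. data \<omega> \<in> E \<and> (\<forall>b<B. h (data \<omega>) (resample b \<omega>) \<in> I b)}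
      = (\<Sum>\<tau>\<in>choices. measure M {\<omega> \<in> space M. joint_at \<tau> \<omega> \<in> C}) / real (card choices)"
    using measure_joint[OF C] by simp
  also have "\<dots> = (\<integral>\<omega>. (\<Sum>\<tau>\<in>choices. indicator {\<omega> \<in> space M. joint_at \<tau> \<omega> \<in> C} \<omega>) / real (card choices) \<partial>M)"
  proof -
    have "{\<omega> \<in> space M. joint_at \<tau> \<omega> \<in> C} \<in> sets M" for \<tau>
      using measurable_sets[OF joint_at_measurable C] by (simp add: vimage_def Int_def conj_commute)
    then show ?thesis by (simp add: Bochner_Integration.integral_sum emeasure_eq_measure)
  qed
  also have "\<dots> = (\<integral>\<omega>. indicator E (data \<omega>) * (\<Prod>b<B. resample_prob n h (data \<omega>) (I b)) \<partial>M)"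
  proof (rule Bochner_Integration.integral_cong[OF refl])
    fix \<omega> assume \<omega>: "\<omega> \<in> space M"
    have "(\<Sum>\<tau>\<in>choices. indicator {\<omega> \<in> space M. joint_at \<tau> \<omega> \<in> C} \<omega>)
        = (\<Sum>\<tau>\<in>choices. indicator E (data \<omega>) * (\<Prod>b<B. indicator (I b) (h (data \<omega>) (restr n (data \<omega> \<circ> \<tau> b)))) :: real)"
    proof (rule sum.cong[OF refl])
      fix \<tau> assume \<tau>: "\<tau> \<in> choices"
      have "(\<Prod>b<B. indicator (I b) (h (data \<omega>) (restr n (data \<omega> \<circ> \<tau> b))) :: real)
          = (if \<forall>b<B. h (data \<omega>) (restr n (data \<omega> \<circ> \<tau> b)) \<in> I b then 1 else 0)"
        by (auto simp: indicator_def)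
      moreover have "joint_at \<tau> \<omega> \<in> C \<longleftrightarrow> data \<omega> \<in> E \<and> (\<forall>b<B. h (data \<omega>) (restr n (data \<omega> \<circ> \<tau> b)) \<in> I b)"
        using measurable_space[OF joint_at_measurable \<omega>, of \<tau>] \<tau> by (auto simp: C_def p_joint_at)
      ultimately show "indicator {\<omega> \<in> space M. joint_at \<tau> \<omega> \<in> C} \<omega>
          = indicator E (data \<omega>) * (\<Prod>b<B. indicator (I b) (h (data \<omega>) (restr n (data \<omega> \<circ> \<tau> b))) :: real)"
        using \<omega> by (simp add: indicator_def)
    qed
    \<comment> \<open>Distributivity in reverse: \<open>choices\<close> is a product of
      \<open>B\<close> copies of \<open>nmaps n\<close>, so the sum factorises over the
      resamples.\<close>
    also have "\<dots> = indicator E (data \<omega>) * (\<Prod>b<B. \<Sum>\<tau>\<in>nmaps n. indicator (I b) (h (data \<omega>) (restr n (data \<omega> \<circ> \<tau>))))"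
      unfolding choices_def by (subst prod_sum_PiE) (auto simp: sum_distrib_left)
    also have "\<dots> / real (card choices) = indicator E (data \<omega>) * (\<Prod>b<B. resample_prob n h (data \<omega>) (I b))"
      unfolding resample_prob_def prod_dividef by (simp add: card_choices)
    finally show "(\<Sum>\<tau>\<in>choices. indicator {\<omega> \<in> space M. joint_at \<tau> \<omega> \<in> C} \<omega>) / real (card choices)
        = indicator E (data \<omega>) * (\<Prod>b<B. resample_prob n h (data \<omega>) (I b))" by simp
  qed
  finally show ?thesis .
qed

end

section \<open>Conditioning on the empirical distribution\<close>

context bootstrap_sample
begin

abbreviation "emp \<omega> \<equiv> empirical D n (\<lambda>i. X i \<omega>)"
abbreviation "G \<equiv> empirical_sigma M D X n"

lemma space_G [simp]: "space G = space M"
  by (simp add: empirical_sigma_def)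

lemma emp_in_space: "\<omega> \<in> space M \<Longrightarrow> emp \<omega> \<in> space (prob_algebra D)"
  using prob_space_empirical[OF n, of "\<lambda>i. X i \<omega>" D] X_space by (simp add: space_prob_algebra)

lemma emp_measurable_G: "(\<lambda>\<omega>. emp \<omega>) \<in> measurable G (prob_algebra D)"
  unfolding empirical_sigma_def by (rule measurable_vimage_algebra1) (use emp_in_space in auto)

lemma measure_emp_measurable_G: "A \<in> sets D \<Longrightarrow> (\<lambda>\<omega>. measure (emp \<omega>) A) \<in> borel_measurable G"
  using measurable_compose[OF measurable_prob_algebraD[OF emp_measurable_G] measurable_measure_subprob_algebra] .

text \<open>\<open>G\<close> is coarser than the sigma-algebra of the data because
  \<open>empirical D n\<close> is measurable.\<close>

lemma sets_G_data:
  assumes "A \<in> sets G" obtains E where "E \<in> sets Dn" "A = {\<omega> \<in> space M. data \<omega> \<in> E}"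
proof -
  have "sets G = {(\<lambda>\<omega>. emp \<omega>) -` A \<inter> space M | A. A \<in> sets (prob_algebra D)}"
    unfolding empirical_sigma_def by (rule sets_vimage_algebra2) (use emp_in_space in auto)
  then obtain A' where A': "A' \<in> sets (prob_algebra D)" "A = (\<lambda>\<omega>. emp \<omega>) -` A' \<inter> space M"
    using assms by auto
  let ?E = "empirical D n -` A' \<inter> space Dn"
  have "?E \<in> sets Dn" using empirical_measurable[OF n] A'(1) by (rule measurable_sets)
  moreover have "A = {\<omega> \<in> space M. data \<omega> \<in> ?E}"
    unfolding A'(2) using data_space by auto
  ultimately show thesis by (rule that)
qed

lemma subalgebra_G: "subalgebra M G"
  unfolding subalgebra_def
proof (intro conjI subsetI)
  fix A assume "A \<in> sets G"
  then obtain E where "E \<in> sets Dn" "A = {\<omega> \<in> space M. data \<omega> \<in> E}" by (rule sets_G_data)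
  then show "A \<in> sets M"
    using measurable_sets[OF data_measurable, of E] by (simp add: vimage_def Int_def conj_commute)
qed simp

section \<open>Symmetric events are determined by the empirical distribution\<close>

text \<open>The symmetrised indicator of \<open>C\<close> without its factor 1 / n!. Values in
  \<open>ennreal\<close> let disjoint unions become infinite sums with no question of
  convergence.\<close>

definition perm_count :: "(nat \<Rightarrow> 'a) set \<Rightarrow> 'w \<Rightarrow> ennreal" where
  "perm_count C \<omega> = (\<Sum>\<sigma> | \<sigma> permutes {..<n}. indicator C (restr n (\<lambda>i. X (\<sigma> i) \<omega>)))"

lemma data_permute_space:
  assumes "\<omega> \<in> space M" shows "restr n (\<lambda>i. X (\<sigma> i) \<omega>) \<in> space Dn"
  unfolding space_PiM restr_def using X_space[OF assms] by (intro PiE_I) auto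

definition pattern :: "(nat \<Rightarrow> 'a set) \<Rightarrow> 'a \<Rightarrow> bool list" where
  "pattern A x = map (\<lambda>i. x \<in> A i) [0..<n]"

definition pattern_card :: "(nat \<Rightarrow> 'a set) \<Rightarrow> 'w \<Rightarrow> bool list \<Rightarrow> nat" where
  "pattern_card A \<omega> = (\<lambda>l\<in>{l. length l = n}. card {j\<in>{..<n}. pattern A (X j \<omega>) = l})"

text \<open>The number of permuted samples in a rectangle depends only on how many observations show
  each pattern of membership in the sides, and these counts are values of the empirical
  distribution.\<close>

lemma perm_count_eqI:
  assumes eq: "pattern_card A \<omega> = pattern_card A \<omega>'"
  shows "perm_count (Pi\<^sub>E {..<n} A) \<omega> = perm_count (Pi\<^sub>E {..<n} A) \<omega>'"
proof -
  have "image_mset (\<lambda>j. pattern A (X j \<omega>)) (mset_set {..<n}) = image_mset (\<lambda>j. pattern A (X j \<omega>')) (mset_set {..<n})"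
  proof (rule multiset_eqI)
    fix l
    have c: "count (image_mset (\<lambda>j. pattern A (X j \<omega>)) (mset_set {..<n})) l = card {j\<in>{..<n}. pattern A (X j \<omega>) = l}" for \<omega>
    proof -
      have "count (image_mset (\<lambda>j. pattern A (X j \<omega>)) (mset_set {..<n})) l
          = (\<Sum>j\<in>{j\<in>{..<n}. pattern A (X j \<omega>) = l}. 1)"
        unfolding count_image_mset' by (rule sum.cong) auto
      then show ?thesis by simp
    qed
    show "count (image_mset (\<lambda>j. pattern A (X j \<omega>)) (mset_set {..<n})) l
        = count (image_mset (\<lambda>j. pattern A (X j \<omega>')) (mset_set {..<n})) l"
    proof (cases "length l = n")
      case True
      then show ?thesis unfolding c using fun_cong[OF eq, of l] by (simp add: pattern_card_def)
    next
      case False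
      then have "pattern A x \<noteq> l" for x by (auto simp: pattern_def)
      then show ?thesis unfolding c by simp
    qed
  qed
  \<comment> \<open>Equal multisets of patterns allow the observations of the two samples to be
    matched so that partners lie in the same sides.\<close>
  then obtain p where p: "p permutes {..<n}" and pp: "\<forall>j\<in>{..<n}. pattern A (X j \<omega>) = pattern A (X (p j) \<omega>')"
    by (rule image_mset_eq_implies_permutes[rotated]) auto
  have mem: "X j \<omega> \<in> A i \<longleftrightarrow> X (p j) \<omega>' \<in> A i" if "j < n" "i < n" for i j
  proof -
    have "pattern A (X j \<omega>) ! i = pattern A (X (p j) \<omega>') ! i" using pp that by auto
    then show ?thesis using that by (simp add: pattern_def)
  qed
  have "perm_count (Pi\<^sub>E {..<n} A) \<omega>
      = (\<Sum>\<sigma> | \<sigma> permutes {..<n}. indicator (Pi\<^sub>E {..<n} A) (restr n (\<lambda>i. X ((p \<circ> \<sigma>) i) \<omega>')))"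
    unfolding perm_count_def
  proof (rule sum.cong[OF refl])
    fix \<sigma> assume "\<sigma> \<in> {\<sigma>. \<sigma> permutes {..<n}}"
    then have "\<sigma> i < n" if "i < n" for i using permutes_in_image[of \<sigma> "{..<n}" i] that by simp
    then show "indicator (Pi\<^sub>E {..<n} A) (restr n (\<lambda>i. X (\<sigma> i) \<omega>))
        = (indicator (Pi\<^sub>E {..<n} A) (restr n (\<lambda>i. X ((p \<circ> \<sigma>) i) \<omega>')) :: ennreal)"
      by (simp add: indicator_def restr_mem_PiE mem)
  qed
  also have "\<dots> = perm_count (Pi\<^sub>E {..<n} A) \<omega>'"
    unfolding perm_count_def
    by (rule setum_permutations_compose_left[OF p, of "\<lambda>\<sigma>. indicator (Pi\<^sub>E {..<n} A) (restr n (\<lambda>i. X (\<sigma> i) \<omega>'))", symmetric])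
  finally show ?thesis .
qed

text \<open>The sides and their complements split the data domain into finitely many atoms, one for
  each pattern, and each count is \<open>n\<close> times the empirical mass of an atom.\<close>

lemma pattern_card_measurable:
  assumes A: "\<And>i. i < n \<Longrightarrow> A i \<in> sets D"
  shows "pattern_card A \<in> measurable G (count_space (Pi\<^sub>E {l. length l = n} (\<lambda>_. {..n})))"
proof -
  let ?L = "{l :: bool list. length l = n}"
  have fin: "finite ?L" using finite_lists_length_eq[of "UNIV :: bool set" n] by simp
  have "(\<lambda>\<omega>. card {j\<in>{..<n}. pattern A (X j \<omega>) = l}) \<in> measurable G (count_space {..n})" if l: "l \<in> ?L" for l
  proof (subst measurable_count_space_eq2_countable)
    define Al where "Al = {x \<in> space D. \<forall>i\<in>{..<n}. x \<in> A i \<longleftrightarrow> l ! i}"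
    have pat: "pattern A x = l \<longleftrightarrow> (\<forall>i<n. x \<in> A i \<longleftrightarrow> l ! i)" for x
      using l by (auto simp: pattern_def list_eq_iff_nth_eq)
    have Al: "Al \<in> sets D"
      unfolding Al_def
    proof (intro sets.sets_Collect_finite_All)
      fix i assume i: "i \<in> {..<n}"
      have "{x \<in> space D. x \<in> A i \<longleftrightarrow> l ! i} = (if l ! i then A i else space D - A i)"
        using sets.sets_into_space[OF A[of i]] i by auto
      then show "{x \<in> space D. x \<in> A i \<longleftrightarrow> l ! i} \<in> sets D" using A[of i] i by simp
    qed simp
    have card: "real (card {j\<in>{..<n}. pattern A (X j \<omega>) = l}) = real n * measure (emp \<omega>) Al" if \<omega>: "\<omega> \<in> space M" for \<omega>
    proof -
      have "real (card {j\<in>{..<n}. pattern A (X j \<omega>) = l}) = (\<Sum>j<n. indicator Al (X j \<omega>))"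
        using X_space[OF \<omega>] by (simp add: indicator_def sum.If_cases Int_def Al_def pat Ball_def)
      then show ?thesis
        using n X_space[OF \<omega>] Al by (subst measure_empirical) auto
    qed
    have eq: "(\<lambda>\<omega>. card {j\<in>{..<n}. pattern A (X j \<omega>) = l}) -` {k} \<inter> space G
        = (\<lambda>\<omega>. real n * measure (emp \<omega>) Al) -` {real k} \<inter> space G" for k
      using card by (auto simp del: of_nat_eq_iff simp: of_nat_eq_iff[where 'a = real, symmetric])
    have "(\<lambda>\<omega>. real n * measure (emp \<omega>) Al) \<in> borel_measurable G"
      using measure_emp_measurable_G[OF Al] by measurable
    then have "(\<lambda>\<omega>. card {j\<in>{..<n}. pattern A (X j \<omega>) = l}) -` {k} \<inter> space G \<in> sets G" for k
      unfolding eq by (rule measurable_sets) simp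
    then show "(\<lambda>\<omega>. card {j\<in>{..<n}. pattern A (X j \<omega>) = l}) \<in> space G \<rightarrow> {..n} \<and>
        (\<forall>a\<in>{..n}. (\<lambda>\<omega>. card {j\<in>{..<n}. pattern A (X j \<omega>) = l}) -` {a} \<inter> space G \<in> sets G)"
      using card_mono[of "{..<n}" "{j\<in>{..<n}. pattern A (X j \<omega>) = l}" for \<omega>] by auto
  qed
  then have "pattern_card A \<in> measurable G (PiM ?L (\<lambda>_. count_space {..n}))"
    unfolding pattern_card_def by (rule measurable_restrict)
  then show ?thesis using fin by (simp add: count_space_PiM_finite)
qed

text \<open>A Dynkin argument: rectangles form an intersection-stable generator, and measurability
  of the count survives complements and disjoint unions.\<close>

lemma perm_count_measurable_G:
  assumes "C \<in> sets Dn"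
  shows "perm_count C \<in> borel_measurable G"
proof -
  have "sets Dn = sigma_sets (space Dn) {Pi\<^sub>E {..<n} A | A. A \<in> (\<Pi> i\<in>{..<n}. sets D)}"
    by (simp add: sets_PiM prod_algebra_eq_finite space_PiM)
  with assms have C: "C \<in> sigma_sets (space Dn) {Pi\<^sub>E {..<n} A | A. A \<in> (\<Pi> i\<in>{..<n}. sets D)}" by simp
  have stable: "Int_stable {Pi\<^sub>E {..<n} A | A. A \<in> (\<Pi> i\<in>{..<n}. sets D)}"
    using Int_stable_prod_algebra[of "{..<n}" "\<lambda>_. D"] by (simp add: prod_algebra_eq_finite)
  have pow: "{Pi\<^sub>E {..<n} A | A. A \<in> (\<Pi> i\<in>{..<n}. sets D)} \<subseteq> Pow (space Dn)"
    using prod_algebra_sets_into_space[of "{..<n}" "\<lambda>_. D"] by (simp add: prod_algebra_eq_finite space_PiM)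
  define N where "N = card {\<sigma>. \<sigma> permutes {..<n}}"
  have total: "perm_count (space Dn) \<omega> = of_nat N" if "\<omega> \<in> space M" for \<omega>
    unfolding perm_count_def indicator_simps(1)[OF data_permute_space[OF that]] N_def
    by (simp only: sum_constant mult_1_right)
  show ?thesis
    using stable pow C
  proof (induction rule: sigma_sets_induct_disjoint)
    case (basic C)
    then obtain A where CA: "C = Pi\<^sub>E {..<n} A" and A: "A \<in> (\<Pi> i\<in>{..<n}. sets D)" by blast
    let ?K = "Pi\<^sub>E {l :: bool list. length l = n} (\<lambda>_. {..n})"
    \<comment> \<open>The count as a function on a discrete space, where measurability is automatic.
      \<open>SOME\<close> picks any sample point with the given pattern counts; by
      \<open>perm_count_eqI\<close> the choice does not matter.\<close>
    let ?\<Phi> = "\<lambda>c. perm_count C (SOME \<omega>. pattern_card A \<omega> = c)"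
    have pc: "pattern_card A \<in> measurable G (count_space ?K)"
      using A by (intro pattern_card_measurable) auto
    have "?\<Phi> \<in> borel_measurable (count_space ?K)" by simp
    from measurable_compose[OF pc this]
    have "(\<lambda>\<omega>. ?\<Phi> (pattern_card A \<omega>)) \<in> borel_measurable G" .
    moreover have "?\<Phi> (pattern_card A \<omega>) = perm_count C \<omega>" for \<omega>
      unfolding CA by (rule perm_count_eqI) (rule someI_ex[of "\<lambda>\<omega>'. pattern_card A \<omega>' = pattern_card A \<omega>"], rule exI, rule refl)
    ultimately show ?case by simp
  next
    case empty
    then show ?case by (simp add: perm_count_def[abs_def])
  next
    case (compl C)
    have "(\<lambda>\<omega>. of_nat N - perm_count C \<omega>) \<in> borel_measurable G"
      using compl(2) by measurable
    moreover have "of_nat N - perm_count C \<omega> = perm_count (space Dn - C) \<omega>" if \<omega>: "\<omega> \<in> space G" for \<omega>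
    proof -
      have "perm_count C \<omega> + perm_count (space Dn - C) \<omega> = perm_count (space Dn) \<omega>"
        unfolding perm_count_def sum.distrib[symmetric]
        using data_permute_space[of \<omega>] \<omega> by (intro sum.cong refl) (simp add: indicator_def)
      also have "\<dots> = of_nat N" using total \<omega> by simp
      finally have *: "perm_count C \<omega> + perm_count (space Dn - C) \<omega> = of_nat N" .
      \<comment> \<open>Finiteness is what permits subtraction in \<open>ennreal\<close>.\<close>
      then have "perm_count C \<omega> \<noteq> \<top>" by auto
      then show ?thesis using * by (metis ennreal_add_diff_cancel_left)
    qed
    ultimately show ?case by (rule measurable_cong[THEN iffD1, rotated])
  next
    case (union F)
    have "(\<lambda>\<omega>. \<Sum>i. perm_count (F i) \<omega>) \<in> borel_measurable G"
      using union by (intro borel_measurable_suminf_order) auto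
    moreover have "(\<Sum>i. perm_count (F i) \<omega>) = perm_count (\<Union>i. F i) \<omega>" for \<omega>
      unfolding perm_count_def suminf_indicator[OF union(1), symmetric]
      by (rule suminf_sum) auto
    ultimately show ?case by simp
  qed
qed

text \<open>For a symmetric event all n! terms of \<open>perm_count\<close> agree, so the event is
  exactly where the count is nonzero.\<close>

lemma symmetric_set_measurable_G:
  assumes E: "E \<in> sets Dn"
    and sym: "\<And>x \<sigma>. x \<in> space Dn \<Longrightarrow> \<sigma> permutes {..<n} \<Longrightarrow> restr n (x \<circ> \<sigma>) \<in> E \<longleftrightarrow> x \<in> E"
  shows "{\<omega> \<in> space M. data \<omega> \<in> E} \<in> sets G"
proof -
  define N where "N = card {\<sigma>. \<sigma> permutes {..<n}}"
  have "N \<noteq> 0" unfolding N_def by (simp add: card_permutations)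
  have perm: "perm_count E \<omega> = of_nat N * indicator E (data \<omega>)" if \<omega>: "\<omega> \<in> space M" for \<omega>
  proof -
    have "restr n (\<lambda>i. X (\<sigma> i) \<omega>) \<in> E \<longleftrightarrow> data \<omega> \<in> E" if \<sigma>: "\<sigma> permutes {..<n}" for \<sigma>
      using sym[OF data_space[OF \<omega>] \<sigma>] restr_permute_permute[OF \<sigma>, of "\<lambda>i. X i \<omega>"] by (simp add: o_def)
    then have "perm_count E \<omega> = (\<Sum>\<sigma> | \<sigma> permutes {..<n}. indicator E (data \<omega>))"
      unfolding perm_count_def by (intro sum.cong refl) (simp add: indicator_def)
    then show ?thesis unfolding N_def by (simp only: sum_constant)
  qed
  have "{\<omega> \<in> space M. data \<omega> \<in> E} = perm_count E -` (- {0}) \<inter> space G"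
    using \<open>N \<noteq> 0\<close> by (auto simp: perm indicator_def split: if_splits)
  moreover have "perm_count E -` (- {0}) \<inter> space G \<in> sets G"
    by (rule measurable_sets[OF perm_count_measurable_G[OF E]]) auto
  ultimately show ?thesis by simp
qed

lemma symmetric_measurable_G:
  fixes f :: "(nat \<Rightarrow> 'a) \<Rightarrow> real"
  assumes f: "f \<in> borel_measurable Dn"
    and sym: "\<And>x \<sigma>. x \<in> space Dn \<Longrightarrow> \<sigma> permutes {..<n} \<Longrightarrow> f (restr n (x \<circ> \<sigma>)) = f x"
  shows "(\<lambda>\<omega>. f (data \<omega>)) \<in> borel_measurable G"
proof (rule measurableI)
  fix S :: "real set" assume S: "S \<in> sets borel"
  have "{\<omega> \<in> space M. data \<omega> \<in> f -` S \<inter> space Dn} \<in> sets G"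
  proof (rule symmetric_set_measurable_G)
    show "f -` S \<inter> space Dn \<in> sets Dn" using f S by (rule measurable_sets)
    fix x \<sigma> assume x: "x \<in> space Dn" and \<sigma>: "\<sigma> permutes {..<n}"
    have "restr n (x \<circ> \<sigma>) \<in> space Dn"
      using x permutes_in_image[OF \<sigma>] unfolding space_PiM restr_def by (intro PiE_I) (auto dest: PiE_mem)
    then show "restr n (x \<circ> \<sigma>) \<in> f -` S \<inter> space Dn \<longleftrightarrow> x \<in> f -` S \<inter> space Dn"
      using x sym[OF x \<sigma>] by simp
  qed
  also have "{\<omega> \<in> space M. data \<omega> \<in> f -` S \<inter> space Dn} = (\<lambda>\<omega>. f (data \<omega>)) -` S \<inter> space G"
    using data_space by auto
  finally show "(\<lambda>\<omega>. f (data \<omega>)) -` S \<inter> space G \<in> sets G" .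
qed simp

text \<open>The tower property: \<open>resample_prob\<close> is the conditional probability given
  the ordered data, and since it is already \<open>G\<close>-measurable, conditioning further on the
  empirical distribution leaves it unchanged.\<close>

theorem real_cond_exp_resample:
  assumes h: "(\<lambda>(x, y). h x y) \<in> borel_measurable (Dn \<Otimes>\<^sub>M Dn)"
    and sym: "\<And>x y \<sigma>. x \<in> space Dn \<Longrightarrow> \<sigma> permutes {..<n} \<Longrightarrow> h (restr n (x \<circ> \<sigma>)) y = h x y"
    and I: "I \<in> sets borel" and b: "b < B"
  shows "AE \<omega> in M. real_cond_exp M G (indicator {\<omega> \<in> space M. h (data \<omega>) (resample b \<omega>) \<in> I}) \<omega>
    = resample_prob n h (data \<omega>) I"
proof -
  interpret fms: finite_measure_subalgebra M G
    by unfold_locales (rule subalgebra_G)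
  define R where "R = {\<omega> \<in> space M. h (data \<omega>) (resample b \<omega>) \<in> I}"
  have "(\<lambda>\<omega>. h (data \<omega>) (resample b \<omega>)) \<in> borel_measurable M"
    using measurable_compose[OF measurable_Pair[OF data_measurable resample_measurable[OF b]] h] by simp
  from measurable_sets[OF this I] have R: "R \<in> sets M"
    by (simp add: R_def vimage_def Int_def conj_commute)
  have F: "(\<lambda>\<omega>. resample_prob n h (data \<omega>) I) \<in> borel_measurable M"
    using measurable_compose[OF data_measurable resample_prob_measurable[OF h I]] .
  have "AE \<omega> in M. real_cond_exp M G (indicator R) \<omega> = resample_prob n h (data \<omega>) I"
  proof (rule fms.real_cond_exp_charact)
    fix A assume A: "A \<in> sets G"
    then obtain E where E: "E \<in> sets Dn" "A = {\<omega> \<in> space M. data \<omega> \<in> E}" by (rule sets_G_data)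
    have AM: "A \<in> sets M" using A subalgebra_G by (auto simp: subalgebra_def)
    \<comment> \<open>The other resamples are left unconstrained and contribute factors 1.\<close>
    let ?I = "\<lambda>c. if c = b then I else UNIV"
    have "(\<integral>\<omega>\<in>A. indicator R \<omega> \<partial>M) = (\<integral>\<omega>. (indicator (A \<inter> R) \<omega> :: real) \<partial>M)"
      unfolding set_lebesgue_integral_def real_scaleR_def indicator_inter_arith ..
    also have "\<dots> = measure M (A \<inter> R)"
      by (simp only: Bochner_Integration.integral_indicator Int_absorb2[OF sets.sets_into_space[OF sets.Int[OF AM R]]])
    also have "A \<inter> R = {\<omega> \<in> space M. data \<omega> \<in> E \<and> (\<forall>c<B. h (data \<omega>) (resample c \<omega>) \<in> ?I c)}"
      using b by (auto simp: E(2) R_def)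
    also have "measure M \<dots> = (\<integral>\<omega>. indicator E (data \<omega>) * (\<Prod>c<B. resample_prob n h (data \<omega>) (?I c)) \<partial>M)"
      using I by (intro measure_resample_statistics h E) auto
    also have "\<dots> = (\<integral>\<omega>\<in>A. resample_prob n h (data \<omega>) I \<partial>M)"
      unfolding set_lebesgue_integral_def
    proof (rule Bochner_Integration.integral_cong[OF refl])
      fix \<omega> assume "\<omega> \<in> space M"
      moreover have "(\<Prod>c<B. resample_prob n h (data \<omega>) (?I c)) = (\<Prod>c<B. if c = b then resample_prob n h (data \<omega>) I else 1)"
        using n by (intro prod.cong refl) (simp add: resample_prob_UNIV)
      ultimately show "indicator E (data \<omega>) * (\<Prod>c<B. resample_prob n h (data \<omega>) (?I c))
          = indicator A \<omega> *\<^sub>R resample_prob n h (data \<omega>) I"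
        using b by (simp add: E(2) indicator_def)
    qed
    finally show "(\<integral>\<omega>\<in>A. indicator R \<omega> \<partial>M) = (\<integral>\<omega>\<in>A. resample_prob n h (data \<omega>) I \<partial>M)" .
  next
    show "integrable M (indicator R :: 'w \<Rightarrow> real)"
      using R by (intro integrable_real_indicator) (simp_all add: emeasure_eq_measure)
    show "integrable M (\<lambda>\<omega>. resample_prob n h (data \<omega>) I)"
      using F by (intro integrable_const_bound[where B = 1])
        (auto simp: resample_prob_nonneg resample_prob_le_1)
    \<comment> \<open>Symmetry enters here: measurability is needed for \<open>G\<close>, not just
      for \<open>M\<close>.\<close>
    show "(\<lambda>\<omega>. resample_prob n h (data \<omega>) I) \<in> borel_measurable G"
      by (intro symmetric_measurable_G resample_prob_measurable h I resample_prob_permute sym)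
  qed
  then show ?thesis by (simp only: R_def)
qed

end

section \<open>The normal limit\<close>

lemma boot_S_eq_rms: "boot_S B e c = rms B (\<lambda>b. e b - c)"
  by (simp add: boot_S_def rms_def)

text \<open>The limit law, laid out like the array it is compared with: coordinate \<open>0\<close>
  for the estimation error, coordinate \<open>Suc b\<close> for resample \<open>b\<close>.\<close>

definition normal_sample :: "real \<Rightarrow> nat \<Rightarrow> (nat \<Rightarrow> real) measure" where
  "normal_sample \<sigma> B = distr (centered_normal \<sigma> \<Otimes>\<^sub>M PiM {..<B} (\<lambda>_. centered_normal \<sigma>)) (PiM {..B} (\<lambda>_. borel))
     (\<lambda>(z, y). \<lambda>j\<in>{..B}. case j of 0 \<Rightarrow> z | Suc b \<Rightarrow> y b)"

lemma sets_normal_pair [measurable_cong]: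
  "sets (centered_normal \<sigma> \<Otimes>\<^sub>M PiM {..<B} (\<lambda>_. centered_normal \<sigma>)) = sets (borel \<Otimes>\<^sub>M PiM {..<B} (\<lambda>_. borel))"
  by (intro sets_pair_measure_cong sets_PiM_cong) auto

lemma normal_sample_map_measurable:
  "(\<lambda>(z, y). \<lambda>j\<in>{..B}. case j of 0 \<Rightarrow> z | Suc b \<Rightarrow> y b)
     \<in> measurable (centered_normal \<sigma> \<Otimes>\<^sub>M PiM {..<B} (\<lambda>_. centered_normal \<sigma>)) (PiM {..B} (\<lambda>_. borel :: real measure))"
  unfolding case_prod_beta measurable_cong_sets[OF sets_normal_pair refl]
proof (rule measurable_restrict)
  fix j :: nat assume "j \<in> {..B}"
  then show "(\<lambda>p. case j of 0 \<Rightarrow> fst p | Suc b \<Rightarrow> snd p b) \<in> borel_measurable (borel \<Otimes>\<^sub>M PiM {..<B} (\<lambda>_. borel :: real measure))"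
    by (cases j) (auto intro!: measurable_compose[OF measurable_snd measurable_component_singleton[of _ _ "\<lambda>_. borel"]])
qed

lemma prob_space_normal_pair:
  "0 < \<sigma> \<Longrightarrow> prob_space (centered_normal \<sigma> \<Otimes>\<^sub>M PiM {..<B} (\<lambda>_. centered_normal \<sigma>))"
  by (intro prob_space_pair prob_space_PiM prob_space_centered_normal)

lemma measure_normal_sample_cuboid:
  assumes \<sigma>: "0 < \<sigma>"
  shows "measure (normal_sample \<sigma> B) (cuboid {..B} a b)
    = measure (centered_normal \<sigma>) {a 0<..b 0} * (\<Prod>c<B. measure (centered_normal \<sigma>) {a (Suc c)<..b (Suc c)})"
proof -
  let ?N = "centered_normal \<sigma>" and ?P = "PiM {..<B} (\<lambda>_. centered_normal \<sigma>)"
  interpret N: prob_space ?N by (rule prob_space_centered_normal[OF \<sigma>])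
  interpret PN: product_prob_space "\<lambda>_. ?N" by (rule product_prob_space_centered_normal[OF \<sigma>])
  interpret P: prob_space ?P by (intro prob_space_PiM prob_space_centered_normal \<sigma>)
  let ?m = "\<lambda>(z, y). \<lambda>j\<in>{..B}. case j of 0 \<Rightarrow> z | Suc b \<Rightarrow> y b"
  let ?A = "Pi\<^sub>E {..<B} (\<lambda>c. {a (Suc c)<..b (Suc c)})"
  have all: "(\<forall>j\<le>B. Q j) \<longleftrightarrow> Q 0 \<and> (\<forall>c<B. Q (Suc c))" for Q
    by (metis Suc_le_eq not0_implies_Suc zero_le)
  have mem: "?m (z, y) \<in> cuboid {..B} a b \<longleftrightarrow> z \<in> {a 0<..b 0} \<and> (\<forall>c<B. y c \<in> {a (Suc c)<..b (Suc c)})" for z y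
  proof -
    have "?m (z, y) \<in> cuboid {..B} a b \<longleftrightarrow> (\<forall>j\<le>B. ?m (z, y) j \<in> {a j<..b j})"
      unfolding cuboid_def by (auto simp: PiE_iff)
    then show ?thesis unfolding all[of "\<lambda>j. ?m (z, y) j \<in> {a j<..b j}"] by (simp add: Suc_le_eq)
  qed
  have "emeasure (normal_sample \<sigma> B) (cuboid {..B} a b)
      = emeasure (?N \<Otimes>\<^sub>M ?P) (?m -` cuboid {..B} a b \<inter> space (?N \<Otimes>\<^sub>M ?P))"
    unfolding normal_sample_def by (rule emeasure_distr[OF normal_sample_map_measurable]) (rule sets_cuboid, simp)
  also have "?m -` cuboid {..B} a b \<inter> space (?N \<Otimes>\<^sub>M ?P) = {a 0<..b 0} \<times> ?A"
  proof (rule set_eqI)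
    fix p :: "real \<times> (nat \<Rightarrow> real)"
    obtain z y where p: "p = (z, y)" by (cases p)
    have "(z, y) \<in> space (?N \<Otimes>\<^sub>M ?P) \<longleftrightarrow> y \<in> extensional {..<B}"
      by (simp add: space_pair_measure space_PiM PiE_iff)
    moreover have "y \<in> ?A \<longleftrightarrow> (\<forall>c<B. y c \<in> {a (Suc c)<..b (Suc c)}) \<and> y \<in> extensional {..<B}"
      by (auto simp: PiE_iff)
    ultimately show "p \<in> ?m -` cuboid {..B} a b \<inter> space (?N \<Otimes>\<^sub>M ?P) \<longleftrightarrow> p \<in> {a 0<..b 0} \<times> ?A"
      unfolding p Int_iff vimage_eq mem mem_Times_iff fst_conv snd_conv by blast
  qed
  also have "emeasure (?N \<Otimes>\<^sub>M ?P) ({a 0<..b 0} \<times> ?A) = emeasure ?N {a 0<..b 0} * emeasure ?P ?A"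
    by (intro P.emeasure_pair_measure_Times sets_PiM_I_finite) auto
  also have "emeasure ?P ?A = (\<Prod>c<B. emeasure ?N {a (Suc c)<..b (Suc c)})"
    by (intro PN.emeasure_PiM) auto
  finally have "emeasure (normal_sample \<sigma> B) (cuboid {..B} a b)
      = ennreal (measure ?N {a 0<..b 0} * (\<Prod>c<B. measure ?N {a (Suc c)<..b (Suc c)}))"
    by (simp add: N.emeasure_eq_measure prod_ennreal ennreal_mult' prod_nonneg)
  then show ?thesis
    by (simp add: measure_def[of "normal_sample \<sigma> B"] prod_nonneg)
qed

lemma measure_normal_ratio:
  assumes \<sigma>: "0 < \<sigma>" and B: "1 \<le> B" and S: "S \<in> sets borel"
  shows "measure (centered_normal \<sigma> \<Otimes>\<^sub>M PiM {..<B} (\<lambda>_. centered_normal \<sigma>))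
      {p \<in> space (centered_normal \<sigma> \<Otimes>\<^sub>M PiM {..<B} (\<lambda>_. centered_normal \<sigma>)). fst p / rms B (snd p) \<in> S}
    = measure (student_t B) S"
proof -
  let ?NP = "centered_normal \<sigma> \<Otimes>\<^sub>M PiM {..<B} (\<lambda>_. centered_normal \<sigma>)"
  have m: "(\<lambda>(z, y). z / rms B y) \<in> borel_measurable ?NP" by measurable
  have "measure (student_t B) S = measure (distr ?NP borel (\<lambda>(z, y). z / rms B y)) S"
    using distr_normal_over_rms[OF \<sigma> B] by simp
  also have "\<dots> = measure ?NP ((\<lambda>(z, y). z / rms B y) -` S \<inter> space ?NP)"
    using m S by (rule measure_distr)
  also have "(\<lambda>(z, y). z / rms B y) -` S \<inter> space ?NP = {p \<in> space ?NP. fst p / rms B (snd p) \<in> S}"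
    by (auto simp: case_prod_beta)
  finally show ?thesis by simp
qed

text \<open>The coverage event becomes a sublevel set of this function. Unlike the studentised ratio
  it involves no division and is continuous even where \<open>rms\<close> vanishes.\<close>

definition t_excess :: "nat \<Rightarrow> real \<Rightarrow> (nat \<Rightarrow> real) \<Rightarrow> real" where
  "t_excess B t y = \<bar>y 0\<bar> - t * rms B (\<lambda>b. y (Suc b))"

lemma continuous_t_excess: "continuous_on UNIV (t_excess B t)"
  unfolding t_excess_def[abs_def] rms_def
  by (intro continuous_intros continuous_on_product_coordinates)

lemma t_excess_measurable: "t_excess B t \<in> borel_measurable (PiM {..B} (\<lambda>_. borel))"
proof -
  have "(\<lambda>y. y j) \<in> borel_measurable (PiM {..B} (\<lambda>_. borel :: real measure))" if "j \<le> B" for j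
    using that by (intro measurable_component_singleton) auto
  then show ?thesis
    unfolding t_excess_def[abs_def] rms_def
    by (intro borel_measurable_diff borel_measurable_abs borel_measurable_times borel_measurable_const
        measurable_compose[OF _ borel_measurable_sqrt] borel_measurable_sum borel_measurable_power) auto
qed

text \<open>Translates conditions on the excess into conditions on the ratio; the two agree off the
  null event that \<open>rms\<close> is zero. It serves both the coverage event and its
  boundary.\<close>

lemma measure_normal_sample_t_excess:
  assumes \<sigma>: "0 < \<sigma>" and B: "1 \<le> B" and S: "S \<in> sets borel"
    and eq: "\<And>z r. 0 < r \<Longrightarrow> \<bar>z\<bar> - t * r \<in> S' \<longleftrightarrow> z / r \<in> S" and S': "S' \<in> sets borel"
  shows "measure (normal_sample \<sigma> B) {y \<in> Pi\<^sub>E {..B} (\<lambda>_. UNIV). t_excess B t y \<in> S'} = measure (student_t B) S"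
proof -
  let ?P = "PiM {..<B} (\<lambda>_. centered_normal \<sigma>)"
  let ?NP = "centered_normal \<sigma> \<Otimes>\<^sub>M ?P"
  let ?m = "\<lambda>(z, y). \<lambda>j\<in>{..B}. case j of 0 \<Rightarrow> z | Suc b \<Rightarrow> y b"
  interpret N: prob_space "centered_normal \<sigma>" by (rule prob_space_centered_normal[OF \<sigma>])
  interpret P: prob_space ?P by (intro prob_space_PiM prob_space_centered_normal \<sigma>)
  interpret NP: pair_prob_space "centered_normal \<sigma>" ?P ..
  have C: "{y \<in> Pi\<^sub>E {..B} (\<lambda>_. UNIV). t_excess B t y \<in> S'} \<in> sets (PiM {..B} (\<lambda>_. borel))"
    using measurable_sets[OF t_excess_measurable S', of B t]
    by (simp add: vimage_def Int_def conj_commute space_PiM)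
  have te: "t_excess B t (?m p) = \<bar>fst p\<bar> - t * rms B (snd p)" for p
    by (simp add: t_excess_def case_prod_beta Suc_le_eq cong: rms_cong)
  have "measure (normal_sample \<sigma> B) {y \<in> Pi\<^sub>E {..B} (\<lambda>_. UNIV). t_excess B t y \<in> S'}
      = measure ?NP (?m -` {y \<in> Pi\<^sub>E {..B} (\<lambda>_. UNIV). t_excess B t y \<in> S'} \<inter> space ?NP)"
    unfolding normal_sample_def by (rule measure_distr[OF normal_sample_map_measurable C])
  also have "?m -` {y \<in> Pi\<^sub>E {..B} (\<lambda>_. UNIV). t_excess B t y \<in> S'} \<inter> space ?NP
      = {p \<in> space ?NP. \<bar>fst p\<bar> - t * rms B (snd p) \<in> S'}"
    unfolding vimage_def Int_def mem_Collect_eq te by (auto simp: case_prod_beta)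
  also have "measure ?NP \<dots> = measure ?NP {p \<in> space ?NP. fst p / rms B (snd p) \<in> S}"
  proof (rule measure_eq_AE)
    have "AE p in ?NP. 0 < rms B (snd p)"
    proof (rule NP.AE_pair_measure)
      have "(\<lambda>p. rms B (snd p)) \<in> borel_measurable ?NP" by measurable
      from measurable_sets[OF this, of "{0<..}"]
      show "{p \<in> space ?NP. 0 < rms B (snd p)} \<in> sets ?NP"
        by (simp add: vimage_def Int_def conj_commute)
      show "AE z in centered_normal \<sigma>. AE y in ?P. 0 < rms B (snd (z, y))"
        using AE_rms_pos[OF \<sigma> B] by simp
    qed
    then show "AE p in ?NP. p \<in> {p \<in> space ?NP. \<bar>fst p\<bar> - t * rms B (snd p) \<in> S'}
        \<longleftrightarrow> p \<in> {p \<in> space ?NP. fst p / rms B (snd p) \<in> S}"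
      by eventually_elim (simp add: eq)
    have "(\<lambda>p. \<bar>fst p\<bar> - t * rms B (snd p)) \<in> borel_measurable ?NP" by measurable
    from measurable_sets[OF this S'] show "{p \<in> space ?NP. \<bar>fst p\<bar> - t * rms B (snd p) \<in> S'} \<in> sets ?NP"
      by (simp add: vimage_def Int_def conj_commute)
    have "(\<lambda>p. fst p / rms B (snd p)) \<in> borel_measurable ?NP" by measurable
    from measurable_sets[OF this S] show "{p \<in> space ?NP. fst p / rms B (snd p) \<in> S} \<in> sets ?NP"
      by (simp add: vimage_def Int_def conj_commute)
  qed
  also have "\<dots> = measure (student_t B) S" by (rule measure_normal_ratio[OF \<sigma> B S])
  finally show ?thesis .
qed

section \<open>Bootstrap asymptotics\<close>

text \<open>Bounded convergence: the deviation is at most e / 2 off an event of probability below e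
  / 2, and at most 1 on it. Mean convergence is the form that can be used under an integral.\<close>

lemma (in prob_space) conv_in_prob_imp_L1:
  fixes Y :: "nat \<Rightarrow> 'a \<Rightarrow> real"
  assumes conv: "conv_in_prob M Y c"
    and meas: "\<forall>\<^sub>F n in sequentially. Y n \<in> borel_measurable M"
    and bound: "\<forall>\<^sub>F n in sequentially. AE \<omega> in M. \<bar>Y n \<omega> - c\<bar> \<le> 1"
  shows "(\<lambda>n. \<integral>\<omega>. \<bar>Y n \<omega> - c\<bar> \<partial>M) \<longlonglongrightarrow> 0"
proof (rule order_tendstoI)
  fix a :: real assume "a < 0"
  then show "\<forall>\<^sub>F n in sequentially. a < (\<integral>\<omega>. \<bar>Y n \<omega> - c\<bar> \<partial>M)"
    by (intro always_eventually allI less_le_trans[OF _ integral_nonneg_AE]) auto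
next
  fix e :: real assume e: "0 < e"
  then have "0 < e / 2" by simp
  then have "(\<lambda>n. measure M {\<omega> \<in> space M. \<bar>Y n \<omega> - c\<bar> > e / 2}) \<longlonglongrightarrow> 0"
    by (rule conv[unfolded conv_in_prob_def, rule_format])
  then have "\<forall>\<^sub>F n in sequentially. measure M {\<omega> \<in> space M. \<bar>Y n \<omega> - c\<bar> > e / 2} < e / 2"
    using e by (intro order_tendstoD) auto
  with meas bound show "\<forall>\<^sub>F n in sequentially. (\<integral>\<omega>. \<bar>Y n \<omega> - c\<bar> \<partial>M) < e"
  proof eventually_elim
    case (elim n)
    note [measurable] = elim(1)
    define A where "A = {\<omega> \<in> space M. \<bar>Y n \<omega> - c\<bar> > e / 2}"
    have A: "A \<in> sets M" unfolding A_def by measurable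
    have "(\<integral>\<omega>. \<bar>Y n \<omega> - c\<bar> \<partial>M) \<le> (\<integral>\<omega>. e / 2 + indicator A \<omega> \<partial>M)"
    proof (rule integral_mono_AE)
      show "integrable M (\<lambda>\<omega>. \<bar>Y n \<omega> - c\<bar>)"
        using elim(2) by (intro integrable_const_bound[where B = 1]) auto
      show "integrable M (\<lambda>\<omega>. e / 2 + indicator A \<omega>)"
        using A by (intro Bochner_Integration.integrable_add integrable_real_indicator) (auto simp: emeasure_eq_measure)
      show "AE \<omega> in M. \<bar>Y n \<omega> - c\<bar> \<le> e / 2 + indicator A \<omega>"
        using elim(2) AE_space
      proof eventually_elim
        case (elim \<omega>)
        then show ?case using e by (cases "\<omega> \<in> A") (auto simp: A_def)
      qed
    qed
    also have "\<dots> = e / 2 + measure M A"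
      using A by (subst Bochner_Integration.integral_add) (auto simp: emeasure_eq_measure prob_space)
    also have "\<dots> < e" using elim(3) by (simp add: A_def)
    finally show ?case .
  qed
qed

text \<open>The index \<open>b0\<close> names the generic resample of the bootstrap hypothesis;
  \<open>b0 < B\<close> ensures that \<open>resamples\<close> governs it.\<close>

locale bootstrap_asymptotics = prob_space M for M :: "'w measure" +
  fixes D P :: "'a measure" and \<psi> :: "'a measure \<Rightarrow> real"
    and X :: "nat \<Rightarrow> 'w \<Rightarrow> 'a" and Xs :: "nat \<Rightarrow> nat \<Rightarrow> nat \<Rightarrow> 'w \<Rightarrow> 'a"
    and B b0 :: nat and \<sigma> :: real
  assumes X: "X i \<in> measurable M D"
    and \<psi>: "1 \<le> n \<Longrightarrow> (\<lambda>x. \<psi> (empirical D n x)) \<in> borel_measurable (PiM {..<n} (\<lambda>_. D))"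
    and B: "1 \<le> B"
    and resamples: "1 \<le> n \<Longrightarrow> bootstrap_resamples M D X n B (Xs n)"
    and \<sigma>: "0 < \<sigma>"
    and weak: "weak_conv_m
        (\<lambda>n. distr M borel (\<lambda>\<omega>. sqrt (real n) * (\<psi> (empirical D n (\<lambda>i. X i \<omega>)) - \<psi> P)))
        (centered_normal \<sigma>)"
    and b0: "b0 < B"
    and cond: "conv_in_prob M
        (\<lambda>n. real_cond_exp M (empirical_sigma M D X n)
           (indicator {\<omega> \<in> space M. sqrt (real n) * (\<psi> (empirical D n (\<lambda>i. Xs n b0 i \<omega>))
              - \<psi> (empirical D n (\<lambda>i. X i \<omega>))) \<le> x}))
        (cdf (centered_normal \<sigma>) x)"
begin

abbreviation "N \<equiv> centered_normal \<sigma>"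

definition Z :: "nat \<Rightarrow> 'w \<Rightarrow> real" where
  "Z n \<omega> = sqrt (real n) * (\<psi> (empirical D n (\<lambda>i. X i \<omega>)) - \<psi> P)"

definition T :: "nat \<Rightarrow> nat \<Rightarrow> 'w \<Rightarrow> real" where
  "T n b \<omega> = sqrt (real n) * (\<psi> (empirical D n (\<lambda>i. Xs n b i \<omega>)) - \<psi> (empirical D n (\<lambda>i. X i \<omega>)))"

definition boot_diff :: "nat \<Rightarrow> (nat \<Rightarrow> 'a) \<Rightarrow> (nat \<Rightarrow> 'a) \<Rightarrow> real" where
  "boot_diff n x y = sqrt (real n) * (\<psi> (empirical D n y) - \<psi> (empirical D n x))"

definition F :: "nat \<Rightarrow> real set \<Rightarrow> 'w \<Rightarrow> real" where
  "F n I \<omega> = resample_prob n (boot_diff n) (restr n (\<lambda>i. X i \<omega>)) I"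

lemma sample: "1 \<le> n \<Longrightarrow> bootstrap_sample M D X n B (Xs n)"
  by unfold_locales (use X resamples in auto)

lemma T_eq: "T n b \<omega> = boot_diff n (restr n (\<lambda>i. X i \<omega>)) (restr n (\<lambda>i. Xs n b i \<omega>))"
  by (simp add: T_def boot_diff_def)

lemma F_bounds: "0 \<le> F n I \<omega>" "F n I \<omega> \<le> 1"
  by (simp_all add: F_def resample_prob_nonneg resample_prob_le_1)

lemma boot_diff_measurable:
  assumes "1 \<le> n"
  shows "(\<lambda>(x, y). boot_diff n x y) \<in> borel_measurable (PiM {..<n} (\<lambda>_. D) \<Otimes>\<^sub>M PiM {..<n} (\<lambda>_. D))"
  unfolding boot_diff_def case_prod_beta
  using measurable_compose[OF measurable_fst \<psi>[OF assms]] measurable_compose[OF measurable_snd \<psi>[OF assms]]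
  by (intro borel_measurable_times borel_measurable_diff borel_measurable_const) auto

lemma F_measurable: "1 \<le> n \<Longrightarrow> I \<in> sets borel \<Longrightarrow> F n I \<in> borel_measurable M"
  unfolding F_def[abs_def]
  using measurable_compose[OF bootstrap_sample.data_measurable[OF sample]
      bootstrap_sample.resample_prob_measurable[OF sample boot_diff_measurable]] by simp

lemma Z_measurable:
  assumes "1 \<le> n" shows "Z n \<in> borel_measurable M"
proof -
  have "(\<lambda>\<omega>. \<psi> (empirical D n (\<lambda>i. X i \<omega>))) \<in> borel_measurable M"
    using measurable_compose[OF bootstrap_sample.data_measurable[OF sample[OF assms]] \<psi>[OF assms]] by simp
  then show ?thesis unfolding Z_def[abs_def] by measurable
qed

lemma T_measurable:
  assumes "1 \<le> n" "b < B" shows "T n b \<in> borel_measurable M"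
  unfolding T_eq[abs_def]
  using measurable_compose[OF measurable_Pair[OF bootstrap_sample.data_measurable[OF sample[OF assms(1)]]
      bootstrap_sample.resample_measurable[OF sample[OF assms(1)] assms(2)]] boot_diff_measurable[OF assms(1)]]
  by simp

lemma real_distribution_N: "real_distribution N"
  using prob_space_centered_normal[OF \<sigma>]
  by (simp add: real_distribution_def real_distribution_axioms_def)

text \<open>\<open>boot_diff\<close> sees the data only through their empirical distribution, so it
  is symmetric in them. This identifies the conditional distribution function of the hypothesis with
  the explicit \<open>F n\<close>.\<close>

lemma cond_exp_eq_F:
  assumes n: "1 \<le> n"
  shows "AE \<omega> in M. real_cond_exp M (empirical_sigma M D X n)
      (indicator {\<omega> \<in> space M. sqrt (real n) * (\<psi> (empirical D n (\<lambda>i. Xs n b0 i \<omega>))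
         - \<psi> (empirical D n (\<lambda>i. X i \<omega>))) \<le> x}) \<omega> = F n {..x} \<omega>"
proof -
  interpret S: bootstrap_sample M D X n B "Xs n" using n by (rule sample)
  have sym: "boot_diff n (restr n (x \<circ> \<tau>)) y = boot_diff n x y"
    if "x \<in> space (PiM {..<n} (\<lambda>_. D))" and \<tau>: "\<tau> permutes {..<n}" for x y \<tau>
  proof -
    have x: "x i \<in> space D" if "i < n" for i
      using \<open>x \<in> space _\<close> that unfolding space_PiM by (auto dest: PiE_mem)
    have "empirical D n (restr n (x \<circ> \<tau>)) = empirical D n x"
      unfolding empirical_restr using n x \<tau> by (rule empirical_permute)
    then show ?thesis by (simp add: boot_diff_def)
  qed
  have set: "{\<omega> \<in> space M. sqrt (real n) * (\<psi> (empirical D n (\<lambda>i. Xs n b0 i \<omega>)) - \<psi> (empirical D n (\<lambda>i. X i \<omega>))) \<le> x}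
      = {\<omega> \<in> space M. boot_diff n (S.data \<omega>) (S.resample b0 \<omega>) \<in> {..x}}"
    by (simp add: boot_diff_def)
  show ?thesis
    unfolding set F_def by (rule S.real_cond_exp_resample[OF boot_diff_measurable[OF n] sym _ b0]) auto
qed

lemma F_atMost_L1: "(\<lambda>n. \<integral>\<omega>. \<bar>F n {..x} \<omega> - cdf N x\<bar> \<partial>M) \<longlonglongrightarrow> 0"
proof (rule conv_in_prob_imp_L1)
  let ?C = "\<lambda>n. real_cond_exp M (empirical_sigma M D X n)
      (indicator {\<omega> \<in> space M. sqrt (real n) * (\<psi> (empirical D n (\<lambda>i. Xs n b0 i \<omega>))
         - \<psi> (empirical D n (\<lambda>i. X i \<omega>))) \<le> x})"
  show "conv_in_prob M (\<lambda>n. F n {..x}) (cdf N x)"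
    unfolding conv_in_prob_def
  proof (intro allI impI)
    fix e :: real assume e: "0 < e"
    have "\<forall>\<^sub>F n in sequentially. measure M {\<omega> \<in> space M. \<bar>?C n \<omega> - cdf N x\<bar> > e}
        = measure M {\<omega> \<in> space M. \<bar>F n {..x} \<omega> - cdf N x\<bar> > e}"
      using eventually_ge_at_top[of 1]
    proof eventually_elim
      case (elim n)
      have [measurable]: "F n {..x} \<in> borel_measurable M" using elim by (rule F_measurable) simp
      show ?case
      proof (rule measure_eq_AE)
        show "AE \<omega> in M. \<omega> \<in> {\<omega> \<in> space M. \<bar>?C n \<omega> - cdf N x\<bar> > e}
            \<longleftrightarrow> \<omega> \<in> {\<omega> \<in> space M. \<bar>F n {..x} \<omega> - cdf N x\<bar> > e}"
          using cond_exp_eq_F[OF elim, of x] by eventually_elim simp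
        have "(\<lambda>\<omega>. \<bar>?C n \<omega> - cdf N x\<bar>) \<in> borel_measurable M"
          by (intro borel_measurable_abs borel_measurable_diff borel_measurable_const borel_measurable_cond_exp2)
        from measurable_sets[OF this, of "{e<..}"]
        show "{\<omega> \<in> space M. \<bar>?C n \<omega> - cdf N x\<bar> > e} \<in> sets M"
          by (simp add: vimage_def Int_def conj_commute)
        have "(\<lambda>\<omega>. \<bar>F n {..x} \<omega> - cdf N x\<bar>) \<in> borel_measurable M" by measurable
        from measurable_sets[OF this, of "{e<..}"]
        show "{\<omega> \<in> space M. \<bar>F n {..x} \<omega> - cdf N x\<bar> > e} \<in> sets M"
          by (simp add: vimage_def Int_def conj_commute)
      qed
    qed
    then show "(\<lambda>n. measure M {\<omega> \<in> space M. \<bar>F n {..x} \<omega> - cdf N x\<bar> > e}) \<longlonglongrightarrow> 0"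
      by (rule Lim_transform_eventually[rotated]) (rule cond[unfolded conv_in_prob_def, rule_format, OF e])
  qed
  show "\<forall>\<^sub>F n in sequentially. F n {..x} \<in> borel_measurable M"
    using eventually_ge_at_top[of 1] by eventually_elim (simp add: F_measurable)
  interpret N: real_distribution N by (rule real_distribution_N)
  have "\<bar>F n {..x} \<omega> - cdf N x\<bar> \<le> 1" for n \<omega>
    using F_bounds[of n "{..x}" \<omega>] N.cdf_nonneg[of x] N.cdf_bounded_prob[of x] by linarith
  then show "\<forall>\<^sub>F n in sequentially. AE \<omega> in M. \<bar>F n {..x} \<omega> - cdf N x\<bar> \<le> 1" by simp
qed

lemma F_integrable:
  assumes "1 \<le> n" "I \<in> sets borel" shows "integrable M (\<lambda>\<omega>. \<bar>F n I \<omega> - c\<bar>)"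
proof (rule integrable_const_bound)
  show "AE \<omega> in M. norm \<bar>F n I \<omega> - c\<bar> \<le> 1 + \<bar>c\<bar>"
  proof (rule AE_I2)
    fix \<omega> show "norm \<bar>F n I \<omega> - c\<bar> \<le> 1 + \<bar>c\<bar>" using F_bounds[of n I \<omega>] by (simp add: abs_if)
  qed
  show "(\<lambda>\<omega>. \<bar>F n I \<omega> - c\<bar>) \<in> borel_measurable M"
    using F_measurable[OF assms] by measurable
qed

lemma F_Ioc_L1: "(\<lambda>n. \<integral>\<omega>. \<bar>F n {a<..b} \<omega> - measure N {a<..b}\<bar> \<partial>M) \<longlonglongrightarrow> 0"
proof (cases "a \<le> b")
  case False
  then show ?thesis by (simp add: F_def resample_prob_def)
next
  case True
  interpret N: real_distribution N by (rule real_distribution_N)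
  have m: "measure N {a<..b} = cdf N b - cdf N a"
    using True N.cdf_diff_eq[of a b] by (cases "a = b") auto
  have bound: "\<forall>\<^sub>F n in sequentially. (\<integral>\<omega>. \<bar>F n {a<..b} \<omega> - measure N {a<..b}\<bar> \<partial>M)
      \<le> (\<integral>\<omega>. \<bar>F n {..b} \<omega> - cdf N b\<bar> \<partial>M) + (\<integral>\<omega>. \<bar>F n {..a} \<omega> - cdf N a\<bar> \<partial>M)"
    using eventually_ge_at_top[of 1]
  proof eventually_elim
    case (elim n)
    have "(\<integral>\<omega>. \<bar>F n {a<..b} \<omega> - measure N {a<..b}\<bar> \<partial>M)
        \<le> (\<integral>\<omega>. \<bar>F n {..b} \<omega> - cdf N b\<bar> + \<bar>F n {..a} \<omega> - cdf N a\<bar> \<partial>M)"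
      using elim by (intro integral_mono F_integrable Bochner_Integration.integrable_add)
        (auto simp: m F_def resample_prob_Ioc[OF True])
    also have "\<dots> = (\<integral>\<omega>. \<bar>F n {..b} \<omega> - cdf N b\<bar> \<partial>M) + (\<integral>\<omega>. \<bar>F n {..a} \<omega> - cdf N a\<bar> \<partial>M)"
      using elim by (intro Bochner_Integration.integral_add F_integrable) auto
    finally show ?case .
  qed
  have lim: "(\<lambda>n. (\<integral>\<omega>. \<bar>F n {..b} \<omega> - cdf N b\<bar> \<partial>M) + (\<integral>\<omega>. \<bar>F n {..a} \<omega> - cdf N a\<bar> \<partial>M)) \<longlonglongrightarrow> 0"
    using tendsto_add[OF F_atMost_L1[of b] F_atMost_L1[of a]] by simp
  show ?thesis
    by (rule tendsto_sandwich[OF always_eventually[OF allI] bound tendsto_const lim])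
      (simp add: integral_nonneg_AE)
qed

lemma Z_Ioc: "(\<lambda>n. measure M {\<omega> \<in> space M. Z n \<omega> \<in> {a<..b}}) \<longlonglongrightarrow> measure N {a<..b}"
proof (cases "a < b")
  case False
  then show ?thesis by simp
next
  case True
  interpret N: real_distribution N by (rule real_distribution_N)
  \<comment> \<open>The limit has no atoms, so weak convergence gives convergence of the
    distribution functions at every point.\<close>
  have "isCont (cdf N) x" for x by (simp add: N.isCont_cdf measure_def)
  then have cdf: "(\<lambda>n. cdf (distr M borel (Z n)) x) \<longlonglongrightarrow> cdf N x" for x
    using weak by (simp add: weak_conv_m_def weak_conv_def Z_def[abs_def])
  have "\<forall>\<^sub>F n in sequentially. cdf (distr M borel (Z n)) b - cdf (distr M borel (Z n)) a
      = measure M {\<omega> \<in> space M. Z n \<omega> \<in> {a<..b}}"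
    using eventually_ge_at_top[of 1]
  proof eventually_elim
    case (elim n)
    interpret Zn: real_distribution "distr M borel (Z n)"
      using Z_measurable[OF elim] by (rule real_distribution_distr)
    have "cdf (distr M borel (Z n)) b - cdf (distr M borel (Z n)) a = measure (distr M borel (Z n)) {a<..b}"
      by (rule Zn.cdf_diff_eq[OF True])
    then show ?case
      by (simp add: measure_distr[OF Z_measurable[OF elim]] vimage_def Int_def conj_commute)
  qed
  moreover have "(\<lambda>n. cdf (distr M borel (Z n)) b - cdf (distr M borel (Z n)) a) \<longlonglongrightarrow> measure N {a<..b}"
    unfolding N.cdf_diff_eq[OF True, symmetric] by (intro tendsto_diff cdf)
  ultimately show ?thesis by (rule Lim_transform_eventually[rotated])
qed

text \<open>Asymptotic independence: each random factor \<open>F n\<close> may be replaced by its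
  constant limit at the price of its mean error, however it depends on \<open>Z n\<close>. What
  remains is the marginal probability of \<open>Z n\<close> times a constant.\<close>

lemma cuboid_tendsto:
  "(\<lambda>n. measure M {\<omega> \<in> space M. Z n \<omega> \<in> {a<..b} \<and> (\<forall>c<B. T n c \<omega> \<in> {l c<..u c})})
     \<longlonglongrightarrow> measure N {a<..b} * (\<Prod>c<B. measure N {l c<..u c})"
proof -
  interpret N: real_distribution N by (rule real_distribution_N)
  let ?p = "\<lambda>c. measure N {l c<..u c}"
  let ?A = "\<lambda>n. measure M {\<omega> \<in> space M. Z n \<omega> \<in> {a<..b} \<and> (\<forall>c<B. T n c \<omega> \<in> {l c<..u c})}"
  let ?z = "\<lambda>n. measure M {\<omega> \<in> space M. Z n \<omega> \<in> {a<..b}}"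
  have "\<forall>\<^sub>F n in sequentially. norm (?A n - ?z n * (\<Prod>c<B. ?p c))
      \<le> (\<Sum>c<B. \<integral>\<omega>. \<bar>F n {l c<..u c} \<omega> - ?p c\<bar> \<partial>M)"
    using eventually_ge_at_top[of 1]
  proof eventually_elim
    case (elim n)
    interpret S: bootstrap_sample M D X n B "Xs n" using elim by (rule sample)
    define E where "E = (\<lambda>x. sqrt (real n) * (\<psi> (empirical D n x) - \<psi> P)) -` {a<..b} \<inter> space S.Dn"
    have "(\<lambda>x. sqrt (real n) * (\<psi> (empirical D n x) - \<psi> P)) \<in> borel_measurable S.Dn"
      by (intro borel_measurable_times borel_measurable_diff borel_measurable_const \<psi> elim)
    then have E: "E \<in> sets S.Dn" unfolding E_def by (rule measurable_sets) simp
    have dE: "S.data \<omega> \<in> E \<longleftrightarrow> Z n \<omega> \<in> {a<..b}" if "\<omega> \<in> space M" for \<omega>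
      using S.data_space[OF that] by (simp add: E_def Z_def)
    have mE: "(\<lambda>\<omega>. indicator E (S.data \<omega>) :: real) \<in> borel_measurable M"
      using measurable_compose[OF S.data_measurable borel_measurable_indicator[OF E]] .
    have mF: "F n {l c<..u c} \<in> borel_measurable M" for c using elim by (rule F_measurable) simp
    have prod_bound: "\<bar>\<Prod>c<B. F n {l c<..u c} \<omega>\<bar> \<le> 1" for \<omega>
      using F_bounds by (auto simp: abs_prod intro!: prod_le_1)
    have "{\<omega> \<in> space M. Z n \<omega> \<in> {a<..b} \<and> (\<forall>c<B. T n c \<omega> \<in> {l c<..u c})}
        = {\<omega> \<in> space M. S.data \<omega> \<in> E \<and> (\<forall>c<B. boot_diff n (S.data \<omega>) (S.resample c \<omega>) \<in> {l c<..u c})}"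
      by (rule Collect_cong) (simp only: dE T_eq cong: conj_cong)
    then have A: "?A n = (\<integral>\<omega>. indicator E (S.data \<omega>) * (\<Prod>c<B. F n {l c<..u c} \<omega>) \<partial>M)"
      using S.measure_resample_statistics[OF boot_diff_measurable[OF elim] E, of "\<lambda>c. {l c<..u c}"]
      by (simp only: F_def) simp
    have "?z n = (\<integral>\<omega>. indicator {\<omega> \<in> space M. Z n \<omega> \<in> {a<..b}} \<omega> \<partial>M)"
    proof -
      have "{\<omega> \<in> space M. Z n \<omega> \<in> {a<..b}} \<inter> space M = {\<omega> \<in> space M. Z n \<omega> \<in> {a<..b}}" by auto
      then show ?thesis by (simp only: Bochner_Integration.integral_indicator)
    qed
    also have "\<dots> = (\<integral>\<omega>. indicator E (S.data \<omega>) \<partial>M)"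
      by (intro Bochner_Integration.integral_cong refl) (simp add: indicator_def dE)
    finally have z: "?z n = (\<integral>\<omega>. indicator E (S.data \<omega>) \<partial>M)" .
    have i1: "integrable M (\<lambda>\<omega>. indicator E (S.data \<omega>) * (\<Prod>c<B. F n {l c<..u c} \<omega>))"
    proof (rule integrable_const_bound[where B = 1])
      show "AE \<omega> in M. norm (indicator E (S.data \<omega>) * (\<Prod>c<B. F n {l c<..u c} \<omega>)) \<le> 1"
        using prod_bound by (intro AE_I2) (simp add: indicator_def)
      show "(\<lambda>\<omega>. indicator E (S.data \<omega>) * (\<Prod>c<B. F n {l c<..u c} \<omega>)) \<in> borel_measurable M"
        by (intro borel_measurable_times borel_measurable_prod mE mF)
    qed
    have i2: "integrable M (\<lambda>\<omega>. indicator E (S.data \<omega>) * (\<Prod>c<B. ?p c))"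
      using mE by (intro integrable_mult_left integrable_const_bound[where B = 1]) (auto simp: indicator_def)
    have diff: "?A n - ?z n * (\<Prod>c<B. ?p c)
        = (\<integral>\<omega>. indicator E (S.data \<omega>) * (\<Prod>c<B. F n {l c<..u c} \<omega>) - indicator E (S.data \<omega>) * (\<Prod>c<B. ?p c) \<partial>M)"
      unfolding A z using i1 i2 by (subst Bochner_Integration.integral_diff) auto
    have "norm (?A n - ?z n * (\<Prod>c<B. ?p c))
        \<le> (\<integral>\<omega>. norm (indicator E (S.data \<omega>) * (\<Prod>c<B. F n {l c<..u c} \<omega>) - indicator E (S.data \<omega>) * (\<Prod>c<B. ?p c)) \<partial>M)"
      unfolding diff by (rule integral_norm_bound)
    also have "\<dots> \<le> (\<integral>\<omega>. (\<Sum>c<B. \<bar>F n {l c<..u c} \<omega> - ?p c\<bar>) \<partial>M)"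
    proof (rule integral_mono)
      show "integrable M (\<lambda>\<omega>. norm (indicator E (S.data \<omega>) * (\<Prod>c<B. F n {l c<..u c} \<omega>) - indicator E (S.data \<omega>) * (\<Prod>c<B. ?p c)))"
        by (rule integrable_norm[OF Bochner_Integration.integrable_diff[OF i1 i2]])
      show "integrable M (\<lambda>\<omega>. \<Sum>c<B. \<bar>F n {l c<..u c} \<omega> - ?p c\<bar>)"
        using elim by (intro Bochner_Integration.integrable_sum F_integrable) auto
      fix \<omega>
      \<comment> \<open>Telescoping: exchanging the factors one by one costs at most the sum of the
        differences, since all factors lie between 0 and 1.\<close>
      have "norm ((\<Prod>c<B. F n {l c<..u c} \<omega>) - (\<Prod>c<B. ?p c)) \<le> (\<Sum>c<B. norm (F n {l c<..u c} \<omega> - ?p c))"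
        using F_bounds by (intro norm_prod_diff) (auto simp: abs_le_iff intro: order_trans[OF _ zero_le_one])
      then show "norm (indicator E (S.data \<omega>) * (\<Prod>c<B. F n {l c<..u c} \<omega>) - indicator E (S.data \<omega>) * (\<Prod>c<B. ?p c))
          \<le> (\<Sum>c<B. \<bar>F n {l c<..u c} \<omega> - ?p c\<bar>)"
        by (cases "S.data \<omega> \<in> E") (simp_all add: sum_nonneg)
    qed
    also have "\<dots> = (\<Sum>c<B. \<integral>\<omega>. \<bar>F n {l c<..u c} \<omega> - ?p c\<bar> \<partial>M)"
      using elim by (intro Bochner_Integration.integral_sum F_integrable) auto
    finally show ?case .
  qed
  moreover have "(\<lambda>n. \<Sum>c<B. \<integral>\<omega>. \<bar>F n {l c<..u c} \<omega> - ?p c\<bar> \<partial>M) \<longlonglongrightarrow> 0"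
    using tendsto_sum[of "{..<B}", OF F_Ioc_L1] by simp
  ultimately have diff: "(\<lambda>n. ?A n - ?z n * (\<Prod>c<B. ?p c)) \<longlonglongrightarrow> 0"
    by (rule Lim_null_comparison)
  have "(\<lambda>n. ?z n * (\<Prod>c<B. ?p c)) \<longlonglongrightarrow> measure N {a<..b} * (\<Prod>c<B. ?p c)"
    by (intro tendsto_mult Z_Ioc tendsto_const)
  then show ?thesis using diff by (rule Lim_transform)
qed

section \<open>The coverage probability\<close>

definition V :: "nat \<Rightarrow> 'w \<Rightarrow> nat \<Rightarrow> real" where
  "V n \<omega> = (\<lambda>j\<in>{..B}. case j of 0 \<Rightarrow> Z n \<omega> | Suc b \<Rightarrow> T n b \<omega>)"

lemma V_measurable: "1 \<le> n \<Longrightarrow> V n \<in> measurable M (PiM {..B} (\<lambda>_. borel))"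
  unfolding V_def[abs_def]
proof (rule measurable_restrict)
  fix j assume "1 \<le> n" "j \<in> {..B}"
  then show "(\<lambda>\<omega>. case j of 0 \<Rightarrow> Z n \<omega> | Suc b \<Rightarrow> T n b \<omega>) \<in> borel_measurable M"
    by (cases j) (simp_all add: Z_measurable T_measurable Suc_le_eq)
qed

lemma V_mem_cuboid: "V n \<omega> \<in> cuboid {..B} a b \<longleftrightarrow> Z n \<omega> \<in> {a 0<..b 0} \<and> (\<forall>c<B. T n c \<omega> \<in> {a (Suc c)<..b (Suc c)})"
proof -
  have "V n \<omega> \<in> cuboid {..B} a b \<longleftrightarrow> (\<forall>j\<le>B. V n \<omega> j \<in> {a j<..b j})"
    unfolding cuboid_def by (auto simp: PiE_iff V_def)
  also have "\<dots> \<longleftrightarrow> V n \<omega> 0 \<in> {a 0<..b 0} \<and> (\<forall>c<B. V n \<omega> (Suc c) \<in> {a (Suc c)<..b (Suc c)})"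
    by (metis Suc_le_eq not0_implies_Suc zero_le)
  finally show ?thesis by (simp add: V_def Suc_le_eq)
qed

lemma t_excess_V: "t_excess B t (V n \<omega>) = \<bar>Z n \<omega>\<bar> - t * rms B (\<lambda>b. T n b \<omega>)"
  by (simp add: t_excess_def V_def Suc_le_eq cong: rms_cong)

theorem coverage_tendsto:
  assumes \<alpha>: "0 < \<alpha>" "\<alpha> < 1"
  defines "t \<equiv> quantile (student_t B) (1 - \<alpha> / 2)"
  shows "(\<lambda>n. measure M {\<omega> \<in> space M. \<bar>Z n \<omega>\<bar> \<le> t * rms B (\<lambda>b. T n b \<omega>)}) \<longlonglongrightarrow> 1 - \<alpha>"
proof -
  \<comment> \<open>The sequence is shifted by one because measurability is available only for n
    \<ge> 1, while \<open>cuboid_convergence\<close> asks for a probability space at every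
    index.\<close>
  let ?Q = "\<lambda>n. distr M (PiM {..B} (\<lambda>_. borel)) (V (Suc n))"
  have V: "V (Suc n) \<in> measurable M (PiM {..B} (\<lambda>_. borel))" for n by (rule V_measurable) simp
  have Q: "measure (?Q n) S = measure M {\<omega> \<in> space M. V (Suc n) \<omega> \<in> S}"
    if "S \<in> sets (PiM {..B} (\<lambda>_. borel))" for n S
    using that by (simp add: measure_distr[OF V] vimage_def Int_def conj_commute)
  interpret C: cuboid_convergence "{..B}" ?Q "normal_sample \<sigma> B"
  proof (rule cuboid_convergence.intro)
    show "prob_space (?Q n)" for n using V by (rule prob_space_distr)
    show "prob_space (normal_sample \<sigma> B)"
      unfolding normal_sample_def
      by (intro prob_space.prob_space_distr prob_space_normal_pair \<sigma> normal_sample_map_measurable)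
    show "sets (normal_sample \<sigma> B) = sets (PiM {..B} (\<lambda>_. borel))" by (simp add: normal_sample_def)
    fix a b :: "nat \<Rightarrow> real"
    have "(\<lambda>n. measure M {\<omega> \<in> space M. V n \<omega> \<in> cuboid {..B} a b}) \<longlonglongrightarrow> measure (normal_sample \<sigma> B) (cuboid {..B} a b)"
      unfolding V_mem_cuboid measure_normal_sample_cuboid[OF \<sigma>] by (rule cuboid_tendsto)
    from LIMSEQ_Suc[OF this]
    show "(\<lambda>n. measure (?Q n) (cuboid {..B} a b)) \<longlonglongrightarrow> measure (normal_sample \<sigma> B) (cuboid {..B} a b)"
      by (subst Q) (simp_all add: sets_cuboid)
  qed auto
  interpret S: real_distribution "student_t B" by (rule real_distribution_student_t[OF B])
  \<comment> \<open>The boundary of the coverage event corresponds to a ratio equal to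
    \<open>t\<close> or \<open>- t\<close>, which are null points of the Student
    distribution.\<close>
  have "measure (normal_sample \<sigma> B) {y \<in> Pi\<^sub>E {..B} (\<lambda>_. UNIV). t_excess B t y \<in> {0}}
      = measure (student_t B) {w. \<bar>w\<bar> = t}"
  proof (rule measure_normal_sample_t_excess[OF \<sigma> B])
    have "finite {w. \<bar>w\<bar> = t}" by (rule finite_subset[of _ "{- t, t}"]) auto
    then show "{w. \<bar>w\<bar> = t} \<in> sets borel" by (intro borel_closed finite_imp_closed)
  qed (auto simp: abs_div field_simps)
  also have "\<dots> \<le> measure (student_t B) ({- t} \<union> {t})"
    by (rule S.finite_measure_mono) auto
  also have "\<dots> \<le> measure (student_t B) {- t} + measure (student_t B) {t}"
    by (rule measure_Un_le) auto
  also have "\<dots> = 0" by (simp add: measure_def emeasure_student_t_singleton)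
  finally have null: "measure (normal_sample \<sigma> B) {y \<in> Pi\<^sub>E {..B} (\<lambda>_. UNIV). t_excess B t y = 0} = 0"
    by (simp add: measure_le_0_iff)
  have "measure (normal_sample \<sigma> B) {y \<in> Pi\<^sub>E {..B} (\<lambda>_. UNIV). t_excess B t y \<in> {..0}} = measure (student_t B) {- t..t}"
    by (rule measure_normal_sample_t_excess[OF \<sigma> B]) (auto simp: field_simps abs_if)
  also have "\<dots> = 1 - \<alpha>"
    unfolding t_def using \<alpha> by (subst measure_student_t_symmetric_interval[OF B]) (auto simp: field_simps)
  finally have lim: "measure (normal_sample \<sigma> B) {y \<in> Pi\<^sub>E {..B} (\<lambda>_. UNIV). t_excess B t y \<le> 0} = 1 - \<alpha>"
    by simp
  have S: "{y \<in> Pi\<^sub>E {..B} (\<lambda>_. UNIV). t_excess B t y \<le> 0} \<in> sets (PiM {..B} (\<lambda>_. borel))"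
    using measurable_sets[OF t_excess_measurable, of "{..0}" B t]
    by (simp add: vimage_def Int_def conj_commute space_PiM)
  have "V n \<omega> \<in> {y \<in> Pi\<^sub>E {..B} (\<lambda>_. UNIV). t_excess B t y \<le> 0} \<longleftrightarrow> \<bar>Z n \<omega>\<bar> \<le> t * rms B (\<lambda>b. T n b \<omega>)" for n \<omega>
    by (simp add: t_excess_V) (simp add: V_def)
  with C.sublevel_tendsto[OF continuous_t_excess null] Q[OF S]
  have "(\<lambda>n. measure M {\<omega> \<in> space M. \<bar>Z (Suc n) \<omega>\<bar> \<le> t * rms B (\<lambda>b. T (Suc n) b \<omega>)}) \<longlonglongrightarrow> 1 - \<alpha>"
    unfolding lim by simp
  then show ?thesis by (rule LIMSEQ_imp_Suc)
qed

end

theorem theorem1: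
  fixes M :: "'w measure" and D P :: "'a measure" and \<psi> :: "'a measure \<Rightarrow> real"
    and X :: "nat \<Rightarrow> 'w \<Rightarrow> 'a" and Xs :: "nat \<Rightarrow> nat \<Rightarrow> nat \<Rightarrow> 'w \<Rightarrow> 'a"
    and B b0 :: nat and \<sigma> \<alpha> :: real
  defines "psi_hat \<equiv> \<lambda>n \<omega>. \<psi> (empirical D n (\<lambda>i. X i \<omega>))"
    and "psi_star \<equiv> \<lambda>n b \<omega>. \<psi> (empirical D n (\<lambda>i. Xs n b i \<omega>))"
  assumes "prob_space M"
    and "P \<in> space (prob_algebra D)"
    and "prob_space.indep_vars M (\<lambda>_. D) X UNIV"
    and "\<And>i. distr M D (X i) = P"
    and "\<And>n. n \<ge> 1 \<Longrightarrow> (\<lambda>x. \<psi> (empirical D n x)) \<in> borel_measurable (PiM {..<n} (\<lambda>_. D))"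
    and "B \<ge> 1"
    and "\<And>n. n \<ge> 1 \<Longrightarrow> bootstrap_resamples M D X n B (Xs n)"
    and "\<sigma> > 0"
    and "weak_conv_m (\<lambda>n. distr M borel (\<lambda>\<omega>. sqrt (real n) * (psi_hat n \<omega> - \<psi> P)))
           (centered_normal \<sigma>)"
    and "b0 < B"
    and "\<And>x. conv_in_prob M
           (\<lambda>n. real_cond_exp M (empirical_sigma M D X n)
              (indicator {\<omega> \<in> space M. sqrt (real n) * (psi_star n b0 \<omega> - psi_hat n \<omega>) \<le> x}))
           (cdf (centered_normal \<sigma>) x)"
    and "0 < \<alpha>" and "\<alpha> < 1"
  shows "(\<lambda>n. measure M {\<omega> \<in> space M.
            \<psi> P \<in> {psi_hat n \<omega> - quantile (student_t B) (1 - \<alpha> / 2) *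
                       boot_S B (\<lambda>b. psi_star n b \<omega>) (psi_hat n \<omega>) ..
                   psi_hat n \<omega> + quantile (student_t B) (1 - \<alpha> / 2) *
                       boot_S B (\<lambda>b. psi_star n b \<omega>) (psi_hat n \<omega>)}})
         \<longlonglongrightarrow> 1 - \<alpha>"
proof -
  interpret prob_space M by fact
  interpret bootstrap_asymptotics M D P \<psi> X Xs B b0 \<sigma>
  proof
    show "X i \<in> measurable M D" for i
      using assms(5) by (simp add: indep_vars_def)
  qed (use assms in \<open>simp_all only: psi_hat_def psi_star_def\<close>)
  let ?t = "quantile (student_t B) (1 - \<alpha> / 2)"
  have "\<forall>\<^sub>F n in sequentially. measure M {\<omega> \<in> space M. \<bar>Z n \<omega>\<bar> \<le> ?t * rms B (\<lambda>b. T n b \<omega>)}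
      = measure M {\<omega> \<in> space M.
            \<psi> P \<in> {psi_hat n \<omega> - ?t * boot_S B (\<lambda>b. psi_star n b \<omega>) (psi_hat n \<omega>) ..
                   psi_hat n \<omega> + ?t * boot_S B (\<lambda>b. psi_star n b \<omega>) (psi_hat n \<omega>)}}"
    using eventually_ge_at_top[of 1]
  proof eventually_elim
    \<comment> \<open>At n = 0 the factor sqrt n vanishes and the scaling cannot be undone, so the
      events are compared only from 1 on.\<close>
    case (elim n)
    have "\<bar>Z n \<omega>\<bar> \<le> ?t * rms B (\<lambda>b. T n b \<omega>)
        \<longleftrightarrow> \<psi> P \<in> {psi_hat n \<omega> - ?t * boot_S B (\<lambda>b. psi_star n b \<omega>) (psi_hat n \<omega>) ..
                 psi_hat n \<omega> + ?t * boot_S B (\<lambda>b. psi_star n b \<omega>) (psi_hat n \<omega>)}" for \<omega>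
    proof -
      have Z: "\<bar>Z n \<omega>\<bar> = sqrt (real n) * \<bar>psi_hat n \<omega> - \<psi> P\<bar>"
        by (simp add: Z_def psi_hat_def abs_mult)
      \<comment> \<open>Homogeneity of \<open>rms\<close> brings the factor sqrt n outside, where it
        cancels against the one in \<open>Z n\<close>.\<close>
      have S: "?t * rms B (\<lambda>b. T n b \<omega>) = sqrt (real n) * (?t * boot_S B (\<lambda>b. psi_star n b \<omega>) (psi_hat n \<omega>))"
        by (simp add: T_def rms_mult boot_S_eq_rms psi_hat_def psi_star_def)
      have "\<bar>Z n \<omega>\<bar> \<le> ?t * rms B (\<lambda>b. T n b \<omega>)
          \<longleftrightarrow> \<bar>psi_hat n \<omega> - \<psi> P\<bar> \<le> ?t * boot_S B (\<lambda>b. psi_star n b \<omega>) (psi_hat n \<omega>)"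
        unfolding Z S using elim by (intro mult_le_cancel_left_pos) simp
      then show ?thesis by auto
    qed
    then show ?case by simp
  qed
  with coverage_tendsto[OF \<open>0 < \<alpha>\<close> \<open>\<alpha> < 1\<close>] show ?thesis
    by (rule Lim_transform_eventually)
qed

end
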